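(* Fix a market $\mathcal M$ with demand-responsive pricing rules and a business $j$. With probability $1$ over the randomness in the history $H^{\mathcal M}$, and for any realization of the prices, the following happens. The posterior beliefs $(\mathcal P^F_{ij},\mathcal P^Q_{ij})$ converge in probability, as $i\to\infty$, to some limit beliefs $\mathcal P^{\lim}_j\in\Delta(\mathbb R)\times\Delta(\mathbb R)$. Moreover, either business $j$ is learned, in which case $(\mathcal P^F_{ij},\mathcal P^Q_{ij})$ converge to (the point masses at) $(\pi_j,Q_j)$, or else $\sigma_j(0,\hat\pi_{ij},\hat Q_{ij},\overline V)\le 0$ for some consumer $i$ (and every consumer afterwards), in which case we say that business $j$ is lost.
   Context: A market $\mathcal M$ with endogenous prices consists of: $m$ businesses $j\in[m]$ with parameters $\pi_j\in(0,1)$ (fit probability) and $Q_j\in[0,1]$ (quality); a value distribution $\mathcal D^V$ on $[0,\infty)$ that is regular (with CDF $\Psi$ and density $\psi$, $v-(1-\Psi(v))/\psi(v)$ is non-decreasing), has a density, and has bounded support with maximum $\overline V$; a common prior $\mathcal P=(\mathcal P^F_j,\mathcal P^Q_j)_{j\in[m]}$ under which all $\pi_j\sim\mathcal P^F_j$, $Q_j\sim\mathcal P^Q_j$ are independent; a search cost $c\ge 0$; and for each business a (possibly randomized) pricing rule $P_j$ mapping a history $H$ to a price $P_j(H)\ge0$. The parameters $(\pi_j,Q_j)_j$ are fixed and are a potential realization of the prior (lie in its support). Dynamics: in round $i=1,2,\dots$ publicly observed prices $P_{ij}=P_j(H^{\mathcal M}_{i-1})$ are set and consumer $i$ arrives with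 value $V_i\sim\mathcal D^V$ (i.i.d., privately known). For each $j$, fit $F_{ij}\sim\mathrm{Bernoulli}(\pi_j)$ and quality realization $q_{ij}\sim\mathrm{Bernoulli}(Q_j)$, all independent. The consumer sequentially and adaptively inspects businesses, paying $c$ per inspection to observe $F_{ij}$; she may stop at any time and transact with at most one inspected business. Transacting with $j$ yields expected transaction utility $V_iQ_jF_{ij}-P_{ij}$ given $F_{ij}$; total utility is transaction utility minus total search cost. After round $i$, the history records the prices, the inspected businesses with their $F_{ij}$, and the business transacted with (if any) with its $q_{ij}$. $H^{\mathcal M}_n$ is the history of the first $n$ rounds ($H^{\mathcal M}$ the infinite one); consumer $i$ sees $H^{\mathcal M}_{i-1}$. No inference about parameters is drawn from prices. Beliefs: $\mathcal P^F_{ij},\mathcal P^Q_{ij}$ are the Bayesian posteriors of $\pi_j,Q_j$ given $H^{\mathcal M}_{i-1}$, with means $\hat\pi_{ij},\hat Q_{ij}$ (for a history realization $H$, written $\hat\pi_j(H),\hat Q_j(H)$). With index $\sigma_j(P,\hat\pi,\hat Q,V)=V\hat Q-P-c/\hat\pi$, consumer $i$ (optimally) inspects the businesses with $\sigma_j(P_{ij},\hat\pi_{ij},\hat Q_{ij},V_i)>0$ in decreasing order of this index and transacts with the first inspected $j$ with $F_{ij}=1$ (if any), then leaves. Pricing rule $P_j$ is demand-responsive if for each history $H=H^{\mathcal M}_{i-1}$ the price $P_{ij}=P_j(H)$ is chosen so that $\sigma_j(P_{ij},\hat\pi_j(H),\hat Q_j(H),\overline V)>0$ if any such $P_{ij}\ge0$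 exists. Business $j$ is learned (for a realization of $H^{\mathcal M}$) if $(\mathcal P^F_{ij},\mathcal P^Q_{ij})\to(\pi_j,Q_j)$ in probability as $i\to\infty$ (posteriors concentrate at the true values). $\Delta(\mathbb R)$ is the set of probability distributions on $\mathbb R$.
   Formalization: Added condition, since the claim fails if prices drive demand to zero: for the given price realization, almost surely, if j is inspected only finitely often and not lost, its index at the posted prices and maximum value does not tend to 0. Convergence of beliefs is also stated under this condition. *)

theory Defs
  imports "HOL-Probability.Probability"
begin

text \<open>The businesses are the elements of a finite type \<open>'b\<close>.  A round record holds the posted prices,
  the fits of the inspected businesses (\<open>None\<close> for a business that was not inspected), and the
  business transacted with together with its quality realization, if any.
  Histories are lists of records with the most recent round at the head.\<close>

datatype 'b round_record =
  Round (prices: "'b \<Rightarrow> real") (fits: "'b \<Rightarrow> bool option") (sale: "('b \<times> bool) option")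

type_synonym 'b history = "'b round_record list"

text \<open>All randomness of one consumer: value, fits, quality realizations.\<close>
type_synonym 'b draw = "real \<times> ('b \<Rightarrow> bool) \<times> ('b \<Rightarrow> bool)"

text \<open>Parameter vectors \<open>(\<pi>, Q)\<close>.\<close>
type_synonym 'b params = "('b \<Rightarrow> real) \<times> ('b \<Rightarrow> real)"

text \<open>A randomized pricing rule is a function of the history and of a random seed; a deterministic
  rule ignores the seed.  The field \<open>tie\<close> lists the businesses in the order in which ties between
  equal indices are broken, which may depend on the public history.\<close>

record ('b, 's) market =
  fit :: "'b \<Rightarrow> real"
  qual :: "'b \<Rightarrow> real"
  psi :: "real \<Rightarrow> real"
  priorF :: "'b \<Rightarrow> real measure"
  priorQ :: "'b \<Rightarrow> real measure"
  cost :: real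
  price :: "'b \<Rightarrow> 'b history \<Rightarrow> 's \<Rightarrow> real"
  tie :: "'b history \<Rightarrow> 'b list"

definition msupport :: "real measure \<Rightarrow> real set" where
  "msupport \<mu> = {x. \<forall>U. open U \<longrightarrow> x \<in> U \<longrightarrow> emeasure \<mu> U > 0}"

definition value_law :: "('b, 's) market \<Rightarrow> real measure" where
  "value_law M = density lborel (\<lambda>v. ennreal (psi M v))"

definition Vbar :: "('b, 's) market \<Rightarrow> real" where
  "Vbar M = Sup (msupport (value_law M))"

text \<open>Computed in \<open>ereal\<close>, the virtual value is \<open>-\<infinity>\<close> where the density vanishes although
  the CDF is still below \<open>1\<close>, and it is \<open>v\<close> where the CDF equals \<open>1\<close> (as \<open>0 / 0 = 0\<close>).\<close>
definition virtual_value :: "('b, 's) market \<Rightarrow> real \<Rightarrow> ereal" where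
  "virtual_value M v = ereal v - ereal (1 - cdf (value_law M) v) / ereal (psi M v)"

definition valid_market :: "('b::finite, 's) market \<Rightarrow> bool" where
  "valid_market M \<longleftrightarrow>
     (\<forall>j. 0 < fit M j \<and> fit M j < 1) \<and>
     (\<forall>j. 0 \<le> qual M j \<and> qual M j \<le> 1) \<and>
     psi M \<in> borel_measurable borel \<and> (\<forall>v. 0 \<le> psi M v) \<and>
     prob_space (value_law M) \<and> (AE v in value_law M. 0 \<le> v) \<and>
     mono_on {0..} (virtual_value M) \<and>
     bounded (msupport (value_law M)) \<and>
     (\<forall>j. real_distribution (priorF M j) \<and> (AE x in priorF M j. 0 < x \<and> x < 1)) \<and>
     (\<forall>j. real_distribution (priorQ M j) \<and> (AE x in priorQ M j. 0 \<le> x \<and> x \<le> 1)) \<and>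
     (\<forall>j. fit M j \<in> msupport (priorF M j) \<and> qual M j \<in> msupport (priorQ M j)) \<and>
     0 \<le> cost M \<and>
     (\<forall>j H z. 0 \<le> price M j H z) \<and>
     (\<forall>H. distinct (tie M H) \<and> set (tie M H) = UNIV)"

text \<open>The index \<open>\<sigma>\<close>, with arguments search cost, price, mean fit, mean quality, value.\<close>
definition sigma_index :: "real \<Rightarrow> real \<Rightarrow> real \<Rightarrow> real \<Rightarrow> real \<Rightarrow> real" where
  "sigma_index c p \<pi>h Qh v = v * Qh - p - c / \<pi>h"

text \<open>The inspection plan contains the businesses of positive index in decreasing order of the index
  (\<open>sort_key\<close> is stable, so ties follow the tie-breaking list).  The consumer carries out the plan
  up to and including the first business with a fit, and transacts with that one.\<close>

definition plan :: "real \<Rightarrow> 'b list \<Rightarrow> ('b \<Rightarrow> real) \<Rightarrow> ('b \<Rightarrow> real) \<Rightarrow> ('b \<Rightarrow> real) \<Rightarrow> real \<Rightarrow> 'b list" where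
  "plan c ts \<pi>h Qh p v =
     (let idx = (\<lambda>j. sigma_index c (p j) (\<pi>h j) (Qh j) v)
      in sort_key (\<lambda>j. - idx j) (filter (\<lambda>j. idx j > 0) ts))"

definition inspections :: "('b \<Rightarrow> bool) \<Rightarrow> 'b list \<Rightarrow> 'b list" where
  "inspections F xs = takeWhile (\<lambda>j. \<not> F j) xs @ take 1 (dropWhile (\<lambda>j. \<not> F j) xs)"

definition play ::
  "real \<Rightarrow> 'b list \<Rightarrow> ('b \<Rightarrow> real) \<Rightarrow> ('b \<Rightarrow> real) \<Rightarrow> ('b \<Rightarrow> real) \<Rightarrow> 'b draw \<Rightarrow> 'b round_record" where
  "play c ts \<pi>h Qh p = (\<lambda>(v, F, q).
     let xs = plan c ts \<pi>h Qh p v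
     in Round p (\<lambda>j. if j \<in> set (inspections F xs) then Some (F j) else None)
          (map_option (\<lambda>j. (j, q j)) (find F xs)))"

definition draw_law :: "('b::finite, 's) market \<Rightarrow> 'b params \<Rightarrow> 'b draw measure" where
  "draw_law M = (\<lambda>(\<pi>, Q). value_law M \<Otimes>\<^sub>M
     (\<Pi>\<^sub>M j\<in>UNIV. measure_pmf (bernoulli_pmf (\<pi> j))) \<Otimes>\<^sub>M
     (\<Pi>\<^sub>M j\<in>UNIV. measure_pmf (bernoulli_pmf (Q j))))"

definition bayes_update :: "'a measure \<Rightarrow> ('a \<Rightarrow> real) \<Rightarrow> 'a measure" where
  "bayes_update \<mu> L = density \<mu> (\<lambda>\<theta>. ennreal (L \<theta>) / (\<integral>\<^sup>+ \<theta>'. ennreal (L \<theta>') \<partial>\<mu>))"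

definition fit_marginal :: "'b params measure \<Rightarrow> 'b \<Rightarrow> real measure" where
  "fit_marginal \<mu> j = distr \<mu> borel (\<lambda>\<theta>. fst \<theta> j)"

definition qual_marginal :: "'b params measure \<Rightarrow> 'b \<Rightarrow> real measure" where
  "qual_marginal \<mu> j = distr \<mu> borel (\<lambda>\<theta>. snd \<theta> j)"

definition mean :: "real measure \<Rightarrow> real" where
  "mean \<nu> = (\<integral>x. x \<partial>\<nu>)"

text \<open>Joint posterior of all parameters: Bayes' rule, round by round.  The likelihood of a record
  \<open>r\<close> after the history \<open>H\<close> is the probability, under the parameters \<open>\<theta>\<close> and given the prices
  recorded in \<open>r\<close>, that a consumer who holds the beliefs induced by \<open>H\<close> generates \<open>r\<close>.  As the
  prices are conditioned upon, nothing is inferred from them.\<close>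

primrec posterior :: "('b::finite, 's) market \<Rightarrow> 'b history \<Rightarrow> 'b params measure" where
  "posterior M [] = (\<Pi>\<^sub>M j\<in>UNIV. priorF M j) \<Otimes>\<^sub>M (\<Pi>\<^sub>M j\<in>UNIV. priorQ M j)"
| "posterior M (r # H) = bayes_update (posterior M H) (\<lambda>\<theta>. measure (draw_law M \<theta>)
     {d \<in> space (draw_law M \<theta>).
        play (cost M) (tie M H)
          (\<lambda>j. mean (fit_marginal (posterior M H) j))
          (\<lambda>j. mean (qual_marginal (posterior M H) j)) (prices r) d = r})"

definition beliefF :: "('b::finite, 's) market \<Rightarrow> 'b history \<Rightarrow> 'b \<Rightarrow> real measure" where
  "beliefF M H = fit_marginal (posterior M H)"

definition beliefQ :: "('b::finite, 's) market \<Rightarrow> 'b history \<Rightarrow> 'b \<Rightarrow> real measure" where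
  "beliefQ M H = qual_marginal (posterior M H)"

text \<open>\<open>\<sigma>\<close> for business \<open>j\<close>, price \<open>p\<close> and value \<open>Vbar\<close>, at the beliefs after the history \<open>H\<close>.\<close>
definition top_index :: "('b::finite, 's) market \<Rightarrow> 'b history \<Rightarrow> 'b \<Rightarrow> real \<Rightarrow> real" where
  "top_index M H j p =
     sigma_index (cost M) p (mean (beliefF M H j)) (mean (beliefQ M H j)) (Vbar M)"

definition demand_responsive :: "('b::finite, 's) market \<Rightarrow> 'b \<Rightarrow> bool" where
  "demand_responsive M j \<longleftrightarrow>
     (\<forall>H z. (\<exists>p\<ge>0. top_index M H j p > 0) \<longrightarrow> top_index M H j (price M j H z) > 0)"

text \<open>Rounds are numbered from \<open>0\<close>, and \<open>hist M s \<omega> i\<close> is the history seen by consumer \<open>i\<close>.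
  The seed used by business \<open>j\<close> in round \<open>i\<close> is \<open>s i j\<close>, and \<open>\<omega> i\<close> is the draw of consumer \<open>i\<close>.\<close>

primrec hist :: "('b::finite, 's) market \<Rightarrow> (nat \<Rightarrow> 'b \<Rightarrow> 's) \<Rightarrow> (nat \<Rightarrow> 'b draw) \<Rightarrow> nat \<Rightarrow> 'b history" where
  "hist M s \<omega> 0 = []"
| "hist M s \<omega> (Suc i) =
     (let H = hist M s \<omega> i
      in play (cost M) (tie M H) (\<lambda>j. mean (beliefF M H j)) (\<lambda>j. mean (beliefQ M H j))
           (\<lambda>j. price M j H (s i j)) (\<omega> i) # H)"

text \<open>The law of the consumers' randomness under the true parameters: i.i.d. draws.\<close>
definition consumer_law :: "('b::finite, 's) market \<Rightarrow> (nat \<Rightarrow> 'b draw) measure" where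
  "consumer_law M = (\<Pi>\<^sub>M i\<in>UNIV. draw_law M (fit M, qual M))"

definition concentrates_at :: "(nat \<Rightarrow> real measure) \<Rightarrow> real \<Rightarrow> bool" where
  "concentrates_at \<mu> x \<longleftrightarrow> (\<forall>\<epsilon>>0. (\<lambda>i. measure (\<mu> i) {y. \<bar>y - x\<bar> > \<epsilon>}) \<longlonglongrightarrow> 0)"

definition learned :: "('b::finite, 's) market \<Rightarrow> (nat \<Rightarrow> 'b history) \<Rightarrow> 'b \<Rightarrow> bool" where
  "learned M h j \<longleftrightarrow>
     concentrates_at (\<lambda>i. beliefF M (h i) j) (fit M j) \<and>
     concentrates_at (\<lambda>i. beliefQ M (h i) j) (qual M j)"

definition lost :: "('b::finite, 's) market \<Rightarrow> (nat \<Rightarrow> 'b history) \<Rightarrow> 'b \<Rightarrow> bool" where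
  "lost M h j \<longleftrightarrow> (\<exists>i. \<forall>i'\<ge>i. top_index M (h i') j 0 \<le> 0)"

definition inspected :: "(nat \<Rightarrow> 'b history) \<Rightarrow> nat \<Rightarrow> 'b \<Rightarrow> bool" where
  "inspected h i j \<longleftrightarrow> fits (hd (h (Suc i))) j \<noteq> None"

text \<open>Demand-responsiveness makes the index at \<open>Vbar\<close> positive but does not keep it from tending
  to \<open>0\<close>, and then the market can fail to learn about a business that is never lost.  Take a single
  business, \<open>c = 0\<close>, uniform priors, values uniform on \<open>[0, 1]\<close>, and the price
  \<open>max 0 (Qh - 2 ^- (i + 2))\<close> in round \<open>i\<close>, where \<open>Qh\<close> is the mean quality.  This rule is
  demand-responsive, but as long as there has been no inspection (so \<open>Qh = 1/2\<close>), consumer \<open>i\<close>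
  inspects with probability \<open>2 ^- (i + 1)\<close> only.  So with positive probability nobody ever
  inspects: the beliefs remain uniform and the index at price \<open>0\<close> remains \<open>1/2\<close>.

  The following condition on the realization \<open>s\<close> of the pricing rules excludes this: if the business
  is inspected only finitely often without being lost, then the index of its posted prices at \<open>Vbar\<close>
  does not tend to \<open>0\<close>.  A demand-responsive rule satisfies it, for instance, if its price is a
  deterministic function of the current beliefs about \<open>j\<close>.\<close>

definition nonvanishing_index ::
  "('b::finite, 's) market \<Rightarrow> (nat \<Rightarrow> 'b \<Rightarrow> 's) \<Rightarrow> 'b \<Rightarrow> bool" where
  "nonvanishing_index M s j \<longleftrightarrow>
     (AE \<omega> in consumer_law M.
        let h = hist M s \<omega> in
        finite {i. inspected h i j} \<longrightarrow> \<not> lost M h j \<longrightarrow>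
        \<not> (\<lambda>i. top_index M (h i) j (price M j (h i) (s i j))) \<longlonglongrightarrow> 0)"

end

(* The likelihood of a round factorises over the businesses, so the beliefs about business j are
   Bayesian updates of its two priors by x^K (1 - x)^L, where K and L count the successes and failures
   among the fits observed at inspections of j (respectively among the quality realisations of its
   sales). The observations of j are Bernoulli trials sampled at predictable times. For such trials, a
   multiplicative functional of the history that contracts in expectation by a fixed factor at every
   trial has a finite sum over the trials; exponential functionals give the law of large numbers along
   the trials, and a functional that halves at every success gives a conditional Borel-Cantelli lemma.

   If j is inspected infinitely often, the law of large numbers makes both posteriors concentrate at
   the true values, because these lie in the supports of the priors. Otherwise the beliefs are
   eventually constant. If moreover the index at price 0 were positive then, by demand-responsiveness
   and the nonvanishing condition, the index of the posted prices at Vbar would exceed some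
   epsilon > 0 infinitely often. Each time, j is inspected with probability bounded below: it suffices
   that the value exceeds Vbar - epsilon and no other business fits. By Borel-Cantelli there would be
   infinitely many inspections, so j is lost. *)

theory Submission
  imports Defs
begin

section \<open>Concentration of Bernoulli posteriors\<close>

text \<open>The seeds are fixed throughout, so the prices of a round are a function of the history,
  and a history of given length takes only countably many values. Filtrations and conditional
  expectations thus reduce to iterated integrals over the next draw.

  The ordinary law of large numbers does not apply directly, because the rounds in which
  \<open>j\<close> is observed are random and depend on the whole market. What saves the argument is
  that whether \<open>j\<close> is inspected does not depend on its own fit in that round, and
  whether it is sold does not depend on its quality realisation. Qualities are seen only at sales,
  so infinitely many inspections must first be shown to give infinitely many sales; this uses
  \<open>fit M j > 0\<close>.

  Bayes' rule can divide by 0 on null histories, so the closed form of the beliefs is proved along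
  \<open>possible\<close> histories only. The priors need not have densities, so concentration
  relies on supports alone. The true quality may be 0 or 1, where the likelihood-ratio bound
  degenerates; these endpoints are treated apart.\<close>

lemma bernoulli_likelihood_ratio:
  fixes x y :: real and K L :: nat
  assumes x: "0 \<le> x" "x \<le> 1" and y: "0 < y" "y < 1"
  shows "x ^ K * (1 - x) ^ L \<le> exp (- (real (K + L) * (x - y)\<^sup>2 / 4)
           + 2 * \<bar>real K - real (K + L) * y\<bar> * (1 / sqrt y + 1 / sqrt (1 - y))) * (y ^ K * (1 - y) ^ L)"
proof -
  define a b a' b' where "a = sqrt x" and "b = sqrt y" and "a' = sqrt (1 - x)" and "b' = sqrt (1 - y)"
  define N where "N = real (K + L)"
  have sq: "a\<^sup>2 = x" "b\<^sup>2 = y" "a'\<^sup>2 = 1 - x" "b'\<^sup>2 = 1 - y"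
    using x y by (auto simp: a_def b_def a'_def b'_def)
  have pos: "0 \<le> a" "a \<le> 1" "0 < b" "b \<le> 1" "0 \<le> a'" "a' \<le> 1" "0 < b'" "b' \<le> 1"
    using x y by (auto simp: a_def b_def a'_def b'_def)
  (* x / y = (sqrt (x / y))^2 <= exp (2 * (sqrt (x / y) - 1)), which turns the likelihood ratio into
     a Hellinger affinity and needs no logarithms at x = 0 or x = 1. *)
  have pw: "u ^ 2 \<le> exp (2 * (u / w - 1)) * w ^ 2" if "0 \<le> u" "0 < w" for u w :: real
  proof -
    have "u / w \<le> exp (u / w - 1)"
      using exp_ge_add_one_self[of "u / w - 1"] by simp
    then have "(u / w)\<^sup>2 \<le> (exp (u / w - 1))\<^sup>2"
      using that by (intro power_mono) auto
    also have "\<dots> = exp (2 * (u / w - 1))" using exp_double[of "u / w - 1"] by simp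
    finally show ?thesis using that by (simp add: power_divide field_simps)
  qed
  have "x ^ K \<le> (exp (2 * (a / b - 1)) * y) ^ K"
    using pw[of a b] pos x unfolding sq by (intro power_mono) auto
  moreover have "(1 - x) ^ L \<le> (exp (2 * (a' / b' - 1)) * (1 - y)) ^ L"
    using pw[of a' b'] pos x unfolding sq by (intro power_mono) auto
  ultimately have "x ^ K * (1 - x) ^ L
      \<le> (exp (2 * (a / b - 1)) * y) ^ K * (exp (2 * (a' / b' - 1)) * (1 - y)) ^ L"
    using x y by (intro mult_mono) auto
  also have "\<dots> = exp (real K * (2 * (a / b - 1)) + real L * (2 * (a' / b' - 1))) * (y ^ K * (1 - y) ^ L)"
    by (simp add: power_mult_distrib exp_of_nat_mult exp_add)
  also have "\<dots> \<le> exp (- (N * (x - y)\<^sup>2 / 4) + 2 * \<bar>real K - N * y\<bar> * (1 / b + 1 / b')) * (y ^ K * (1 - y) ^ L)"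
  proof (intro mult_right_mono)
    have yb: "y / b = b" "(1 - y) / b' = b'"
      using sq pos by (simp_all add: power2_eq_square field_simps)
    \<comment> \<open>Both counts are split into their values under \<open>y\<close> and a
      deviation: \<open>K\<close> deviates from \<open>N * y\<close> by \<open>K - N * y\<close>,
      and \<open>L\<close> from \<open>N * (1 - y)\<close> by the opposite amount. With
      \<open>y / b = b\<close> and \<open>(1 - y) / b' = b'\<close> the main parts add up to
      \<open>N\<close> times the affinity \<open>a * b + a' * b'\<close>.\<close>
    have e1: "real K * (a / b) = N * a * (y / b) + (real K - N * y) * (a / b)"
      using pos by (simp add: field_simps)
    have e2: "real L * (a' / b') = N * a' * ((1 - y) / b') - (real K - N * y) * (a' / b')"
      using pos by (simp add: field_simps N_def)
    have "real K * (2 * (a / b - 1)) + real L * (2 * (a' / b' - 1))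
        = 2 * (real K * (a / b)) + 2 * (real L * (a' / b')) - 2 * N"
      by (simp add: algebra_simps N_def)
    also have "\<dots> = N * (2 * (a * b + a' * b' - 1)) + 2 * ((real K - N * y) * (a / b - a' / b'))"
      unfolding e1 e2 yb by (simp add: algebra_simps)
    finally have e: "real K * (2 * (a / b - 1)) + real L * (2 * (a' / b' - 1))
        = N * (2 * (a * b + a' * b' - 1)) + 2 * ((real K - N * y) * (a / b - a' / b'))" .
    \<comment> \<open>Up to normalisation this is minus the squared Hellinger distance of the two
      Bernoulli laws; the identity holds because both pairs of square roots are unit
      vectors.\<close>
    have s1: "2 * (a * b + a' * b' - 1) = - ((a - b)\<^sup>2 + (a' - b')\<^sup>2)"
    proof -
      have "a\<^sup>2 + b\<^sup>2 + a'\<^sup>2 + b'\<^sup>2 = 2" by (simp add: sq)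
      then show ?thesis by (simp add: power2_diff)
    qed
    have s2: "(x - y)\<^sup>2 / 4 \<le> (a - b)\<^sup>2 + (a' - b')\<^sup>2"
    proof -
      have "(x - y)\<^sup>2 = (a - b)\<^sup>2 * (a + b)\<^sup>2"
        by (simp flip: sq add: power2_eq_square algebra_simps)
      also have "\<dots> \<le> (a - b)\<^sup>2 * 2\<^sup>2"
        using pos by (intro mult_left_mono power_mono) auto
      finally show ?thesis by (simp add: add_increasing2)
    qed
    have s3: "(real K - N * y) * (a / b - a' / b') \<le> \<bar>real K - N * y\<bar> * (1 / b + 1 / b')"
    proof -
      have "\<bar>a / b - a' / b'\<bar> \<le> a / b + a' / b'" using pos by (auto simp: abs_le_iff)
      also have "\<dots> \<le> 1 / b + 1 / b'" using pos by (intro add_mono divide_right_mono) auto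
      finally have "\<bar>real K - N * y\<bar> * \<bar>a / b - a' / b'\<bar> \<le> \<bar>real K - N * y\<bar> * (1 / b + 1 / b')"
        by (intro mult_left_mono) auto
      then show ?thesis unfolding abs_mult[symmetric] by (rule order_trans[OF abs_ge_self])
    qed
    have "N * (2 * (a * b + a' * b' - 1)) \<le> N * (- ((x - y)\<^sup>2 / 4))"
      using s1 s2 by (intro mult_left_mono) (auto simp: N_def)
    with s3 show "exp (real K * (2 * (a / b - 1)) + real L * (2 * (a' / b' - 1)))
       \<le> exp (- (N * (x - y)\<^sup>2 / 4) + 2 * \<bar>real K - N * y\<bar> * (1 / b + 1 / b'))"
      unfolding exp_le_cancel_iff e by simp
    show "0 \<le> y ^ K * (1 - y) ^ L" using y by simp
  qed
  finally show ?thesis unfolding N_def b_def b'_def .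
qed

text \<open>The comparison must be uniform over a whole neighbourhood of \<open>p\<close>, since a
  prior supported at \<open>p\<close> need not give \<open>p\<close> itself any mass. For
  \<open>p\<close> inside the unit interval the ratio bound does this; at the endpoints its factor
  \<open>1 / sqrt y + 1 / sqrt (1 - y)\<close> is unbounded, but there one count vanishes and the
  likelihood is a plain power.\<close>

lemma bernoulli_likelihood_separation:
  fixes p \<epsilon> :: real and K L :: "nat \<Rightarrow> nat"
  assumes p: "0 \<le> p" "p \<le> 1" and \<epsilon>: "0 < \<epsilon>"
    and lim: "(\<lambda>i. real (K i) / real (K i + L i)) \<longlonglongrightarrow> p"
    and p0: "p = 0 \<Longrightarrow> \<forall>i. K i = 0" and p1: "p = 1 \<Longrightarrow> \<forall>i. L i = 0"
  shows "\<exists>\<delta>>0. \<exists>\<rho>\<ge>0. \<rho> < 1 \<and> (\<forall>\<^sub>F i in sequentially. \<forall>x y. 0 \<le> x \<longrightarrow> x \<le> 1 \<longrightarrow> 0 \<le> y \<longrightarrow> y \<le> 1 \<longrightarrow>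
     \<epsilon> < \<bar>x - p\<bar> \<longrightarrow> \<bar>y - p\<bar> < \<delta> \<longrightarrow>
     x ^ K i * (1 - x) ^ L i \<le> \<rho> ^ (K i + L i) * (y ^ K i * (1 - y) ^ L i))"
proof -
  \<comment> \<open>The constant comes from
    \<open>1 - \<epsilon> \<le> (1 - \<epsilon> / 2)\<^sup>2\<close>. It is applied to
    \<open>1 - x\<close> and \<open>1 - y\<close> if \<open>p = 0\<close>, and to \<open>x\<close>
    and \<open>y\<close> if \<open>p = 1\<close>. The \<open>max 0\<close> keeps the base
    nonnegative for large \<open>\<epsilon>\<close>, where no such \<open>u\<close> exists.\<close>
  have edge: "u ^ n \<le> max 0 (1 - \<epsilon> / 2) ^ n * w ^ n"
    if "0 \<le> u" "u < 1 - \<epsilon>" "1 - \<epsilon> / 2 < w" for u w :: real and n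
  proof -
    have "1 - \<epsilon> \<le> (1 - \<epsilon> / 2) * (1 - \<epsilon> / 2)"
      by (simp add: algebra_simps)
    then have "u \<le> (1 - \<epsilon> / 2) * (1 - \<epsilon> / 2)" using that by linarith
    also have "\<dots> \<le> (1 - \<epsilon> / 2) * w" using that by (intro mult_left_mono) auto
    finally show ?thesis
      unfolding power_mult_distrib[symmetric] using that by (intro power_mono) (auto simp: max_def)
  qed
  consider "p = 0" | "p = 1" | "0 < p" "p < 1" using p by linarith
  then show ?thesis
  proof cases
    case 1
    show ?thesis
      using \<epsilon> edge 1 p0
      by (intro exI[of _ "\<epsilon> / 2"] conjI exI[of _ "max 0 (1 - \<epsilon> / 2)"]) (auto intro!: always_eventually)
  next
    case 2
    show ?thesis
      using \<epsilon> edge 2 p1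
      by (intro exI[of _ "\<epsilon> / 2"] conjI exI[of _ "max 0 (1 - \<epsilon> / 2)"]) (auto intro!: always_eventually)
  next
    case 3
    \<comment> \<open>Staying within \<open>g\<close> of \<open>p\<close> keeps \<open>y\<close> and
      \<open>1 - y\<close> above \<open>g\<close>, so \<open>C\<close> bounds the sum of the inverse
      roots. Per trial, the separation \<open>\<bar>x - y\<bar> \<ge> \<epsilon> / 2\<close> gains
      \<open>\<epsilon>\<^sup>2 / 16\<close> in the exponent and the deviation, at most
      \<open>2 * \<delta>\<close>, costs \<open>4 * \<delta> * C\<close>. The choice of
      \<open>\<delta>\<close> makes this cost at most half the gain, which leaves
      \<open>\<epsilon>\<^sup>2 / 32\<close>.\<close>
    define g where "g = min p (1 - p) / 2"
    define C where "C = 2 / sqrt g"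
    have g: "0 < g" "g \<le> p / 2" "g \<le> (1 - p) / 2" using 3 by (auto simp: g_def)
    have C: "C > 0" using g by (simp add: C_def)
    define \<delta> where "\<delta> = min (min g (\<epsilon> / 2)) (\<epsilon>\<^sup>2 / (128 * C))"
    have \<delta>: "0 < \<delta>" "\<delta> \<le> g" "\<delta> \<le> \<epsilon> / 2" "\<delta> \<le> \<epsilon>\<^sup>2 / (128 * C)"
      using g \<epsilon> C by (auto simp: \<delta>_def)
    have \<delta>C: "4 * \<delta> * C \<le> \<epsilon>\<^sup>2 / 32" using \<delta>(4) C by (simp add: field_simps)
    define \<rho> where "\<rho> = exp (- (\<epsilon>\<^sup>2 / 32))"
    have ev: "\<forall>\<^sub>F i in sequentially. \<bar>real (K i) / real (K i + L i) - p\<bar> < \<delta>"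
      using tendstoD[OF lim \<open>0 < \<delta>\<close>] by (simp add: dist_real_def)
    have main: "x ^ K i * (1 - x) ^ L i \<le> \<rho> ^ (K i + L i) * (y ^ K i * (1 - y) ^ L i)"
      if i: "\<bar>real (K i) / real (K i + L i) - p\<bar> < \<delta>" and x: "0 \<le> x" "x \<le> 1"
        and "\<epsilon> < \<bar>x - p\<bar>" "\<bar>y - p\<bar> < \<delta>" for i x y
    proof -
      let ?N = "real (K i + L i)"
      have "g < y \<and> g < 1 - y" using \<open>\<bar>y - p\<bar> < \<delta>\<close> \<delta>(2) g unfolding abs_less_iff by argo
      then have y: "g < y" "g < 1 - y" by auto
      \<comment> \<open>Without observations the frequency is \<open>0 / 0 = 0\<close>, which is too
        far from \<open>p\<close> since \<open>\<delta> \<le> g \<le> p / 2\<close>.\<close>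
      have N: "?N > 0"
      proof (rule ccontr)
        assume "\<not> ?N > 0"
        then have "?N = 0" by linarith
        then show False using i g \<delta> 3 by simp
      qed
      have "1 / sqrt y + 1 / sqrt (1 - y) \<le> 1 / sqrt g + 1 / sqrt g"
        using y g by (intro add_mono divide_left_mono) auto
      then have c: "1 / sqrt y + 1 / sqrt (1 - y) \<le> C" by (simp add: C_def)
      have "\<bar>real (K i) / ?N - y\<bar> \<le> 2 * \<delta>"
        using i \<open>\<bar>y - p\<bar> < \<delta>\<close> by linarith
      then have "?N * \<bar>real (K i) / ?N - y\<bar> \<le> ?N * (2 * \<delta>)"
        using N by (intro mult_left_mono) auto
      moreover have "?N * \<bar>real (K i) / ?N - y\<bar> = \<bar>?N * (real (K i) / ?N - y)\<bar>"
        using N by (simp add: abs_mult)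
      moreover have "?N * (real (K i) / ?N - y) = real (K i) - ?N * y"
        using N by (simp add: field_simps)
      ultimately have dev: "\<bar>real (K i) - ?N * y\<bar> \<le> ?N * (2 * \<delta>)" by (simp only:)
      have "\<epsilon> / 2 \<le> \<bar>x - y\<bar>" using that(4,5) \<delta>(3) by argo
      then have "(\<epsilon> / 2)\<^sup>2 \<le> \<bar>x - y\<bar>\<^sup>2"
        using \<epsilon> by (intro power_mono) auto
      then have sep: "\<epsilon>\<^sup>2 / 4 \<le> (x - y)\<^sup>2" by (simp add: power_divide)
      have "- (?N * (x - y)\<^sup>2 / 4) + 2 * \<bar>real (K i) - ?N * y\<bar> * (1 / sqrt y + 1 / sqrt (1 - y))
         \<le> - (?N * (\<epsilon>\<^sup>2 / 4) / 4) + 2 * (?N * (2 * \<delta>)) * C"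
        using sep N dev c y g
        by (intro add_mono mult_mono le_imp_neg_le divide_right_mono) auto
      also have "\<dots> = ?N * (- (\<epsilon>\<^sup>2 / 16) + 4 * \<delta> * C)" by (simp add: algebra_simps)
      also have "\<dots> \<le> ?N * (- (\<epsilon>\<^sup>2 / 32))" using \<delta>C N by (intro mult_left_mono) auto
      finally have "exp (- (?N * (x - y)\<^sup>2 / 4)
           + 2 * \<bar>real (K i) - ?N * y\<bar> * (1 / sqrt y + 1 / sqrt (1 - y))) \<le> \<rho> ^ (K i + L i)"
        unfolding \<rho>_def exp_of_nat_mult[symmetric] by simp
      then show ?thesis
        using y g
        by (intro order_trans[OF bernoulli_likelihood_ratio[OF x, of y]]) (auto intro!: mult_right_mono)
    qed
    have "\<rho> < 1" using \<epsilon> by (simp add: \<rho>_def)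
    moreover have "\<rho> \<ge> 0" by (simp add: \<rho>_def)
    moreover have "\<forall>\<^sub>F i in sequentially. \<forall>x y. 0 \<le> x \<longrightarrow> x \<le> 1 \<longrightarrow> 0 \<le> y \<longrightarrow> y \<le> 1 \<longrightarrow>
       \<epsilon> < \<bar>x - p\<bar> \<longrightarrow> \<bar>y - p\<bar> < \<delta> \<longrightarrow>
       x ^ K i * (1 - x) ^ L i \<le> \<rho> ^ (K i + L i) * (y ^ K i * (1 - y) ^ L i)"
      using ev by eventually_elim (use main in blast)
    ultimately show ?thesis using \<delta>(1) by blast
  qed
qed

text \<open>At a point \<open>x\<close> other than \<open>p\<close>, the two cdfs differ by at most
  the mass farther than \<open>\<bar>x - p\<bar> / 2\<close> from \<open>p\<close>. At
  \<open>p\<close> the limit cdf jumps, so weak convergence asks nothing there.\<close>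

lemma weak_conv_concentrates_at:
  assumes \<mu>: "\<And>i. real_distribution (\<mu> i)" and conc: "concentrates_at \<mu> p"
  shows "weak_conv_m \<mu> (return borel p)"
proof -
  have cdf_p: "cdf (return borel p) x = (if p \<le> x then 1 else 0)" for x
    by (simp add: cdf_def measure_return indicator_def)
  show ?thesis
    unfolding weak_conv_m_def weak_conv_def
  proof (intro allI impI)
    fix x
    assume cont: "isCont (cdf (return borel p)) x"
    have "x \<noteq> p"
    proof
      assume "x = p"
      then have "cdf (return borel p) \<midarrow>p\<rightarrow> 1" using cont by (simp add: isCont_def cdf_p)
      then have "(cdf (return borel p) \<longlongrightarrow> 1) (at_left p)" 
        by (rule tendsto_mono[rotated]) (simp add: at_le)
      moreover have "\<forall>\<^sub>F y in at_left p. cdf (return borel p) y = 0"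
        by (auto simp: cdf_p eventually_at_left_field intro!: exI[of _ "p - 1"])
      then have "(cdf (return borel p) \<longlongrightarrow> 0) (at_left p)"
        by (rule tendsto_eventually)
      ultimately show False
        using tendsto_unique[of "at_left p" "cdf (return borel p)" 1 0] by simp
    qed
    define \<epsilon> where "\<epsilon> = \<bar>x - p\<bar> / 2"
    have \<epsilon>: "\<epsilon> > 0" using \<open>x \<noteq> p\<close> by (simp add: \<epsilon>_def)
    have lim: "(\<lambda>i. measure (\<mu> i) {y. \<bar>y - p\<bar> > \<epsilon>}) \<longlonglongrightarrow> 0"
      using conc \<epsilon> by (simp add: concentrates_at_def)
    have "\<bar>cdf (\<mu> i) x - cdf (return borel p) x\<bar> \<le> measure (\<mu> i) {y. \<bar>y - p\<bar> > \<epsilon>}" for i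
    proof -
      interpret real_distribution "\<mu> i" by (rule \<mu>)
      show ?thesis
      proof (cases "p \<le> x")
        case True
        have "1 - cdf (\<mu> i) x = prob (space (\<mu> i) - {..x})"
          by (subst prob_compl) (simp_all add: cdf_def)
        also have "\<dots> \<le> prob {y. \<bar>y - p\<bar> > \<epsilon>}"
          using \<epsilon> True by (intro finite_measure_mono) (auto simp: \<epsilon>_def)
        finally show ?thesis using True cdf_bounded_prob[of x] by (simp add: cdf_p)
      next
        case False
        have le: "cdf (\<mu> i) x \<le> prob {y. \<bar>y - p\<bar> > \<epsilon>}"
          unfolding cdf_def using \<epsilon> False by (intro finite_measure_mono) (auto simp: \<epsilon>_def)
        then show ?thesis using False cdf_nonneg[of x] by (simp add: cdf_p)
      qed
    qed
    then show "(\<lambda>i. cdf (\<mu> i) x) \<longlonglongrightarrow> cdf (return borel p) x"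
      by (intro LIM_zero_cancel[OF Lim_null_comparison[OF always_eventually lim]]) simp
  qed
qed

section \<open>Bayes updates, and posteriors for Bernoulli likelihoods\<close>

lemma emeasure_bayes_update:
  assumes "L \<in> borel_measurable \<mu>" "A \<in> sets \<mu>"
  shows "emeasure (bayes_update \<mu> L) A
    = (\<integral>\<^sup>+\<theta>. ennreal (L \<theta>) * indicator A \<theta> \<partial>\<mu>) / (\<integral>\<^sup>+\<theta>. ennreal (L \<theta>) \<partial>\<mu>)"
proof -
  have "emeasure (bayes_update \<mu> L) A
      = (\<integral>\<^sup>+\<theta>. ennreal (L \<theta>) * indicator A \<theta> / (\<integral>\<^sup>+\<theta>. ennreal (L \<theta>) \<partial>\<mu>) \<partial>\<mu>)"
    unfolding bayes_update_def using assms
    by (subst emeasure_density)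
      (auto intro!: nn_integral_cong simp: divide_ennreal_def ac_simps)
  also have "\<dots> = (\<integral>\<^sup>+\<theta>. ennreal (L \<theta>) * indicator A \<theta> \<partial>\<mu>) / (\<integral>\<^sup>+\<theta>. ennreal (L \<theta>) \<partial>\<mu>)"
    using assms by (intro nn_integral_divide) simp
  finally show ?thesis .
qed

lemma sets_bayes_update [simp]: "sets (bayes_update \<mu> L) = sets \<mu>"
  and space_bayes_update [simp]: "space (bayes_update \<mu> L) = space \<mu>"
  by (simp_all add: bayes_update_def)

lemma bayes_update_scale:
  assumes "L \<in> borel_measurable \<mu>" "0 < w"
  shows "bayes_update \<mu> (\<lambda>\<theta>. w * L \<theta>) = bayes_update \<mu> L"
proof -
  have *: "ennreal (w * L \<theta>) = ennreal w * ennreal (L \<theta>)" for \<theta>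
    using assms(2) by (simp add: ennreal_mult')
  have "ennreal w * a / (ennreal w * b) = a / b" for a b
    using assms(2) divide_mult_eq[of "ennreal w" a b] by (simp add: mult.commute)
  then show ?thesis
    unfolding bayes_update_def * using assms by (simp add: nn_integral_cmult)
qed

text \<open>The normalising constant of the first update cancels, which requires it to be neither 0
  nor infinite. This is what confines the closed form of the posterior to histories of positive
  probability.\<close>

lemma bayes_update_bayes_update:
  assumes [measurable]: "L \<in> borel_measurable \<mu>" "L' \<in> borel_measurable \<mu>"
    and "AE \<theta> in \<mu>. 0 \<le> L \<theta>"
    and I: "(\<integral>\<^sup>+\<theta>. ennreal (L \<theta>) \<partial>\<mu>) \<noteq> 0" "(\<integral>\<^sup>+\<theta>. ennreal (L \<theta>) \<partial>\<mu>) \<noteq> \<infinity>"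
  shows "bayes_update (bayes_update \<mu> L) L' = bayes_update \<mu> (\<lambda>\<theta>. L \<theta> * L' \<theta>)"
proof -
  let ?I = "\<integral>\<^sup>+\<theta>. ennreal (L \<theta>) \<partial>\<mu>"
  have I': "(\<integral>\<^sup>+\<theta>. ennreal (L' \<theta>) \<partial>bayes_update \<mu> L) = (\<integral>\<^sup>+\<theta>. ennreal (L \<theta> * L' \<theta>) \<partial>\<mu>) / ?I"
  proof -
    have "(\<integral>\<^sup>+\<theta>. ennreal (L' \<theta>) \<partial>bayes_update \<mu> L) = (\<integral>\<^sup>+\<theta>. ennreal (L \<theta>) / ?I * ennreal (L' \<theta>) \<partial>\<mu>)"
      unfolding bayes_update_def by (subst nn_integral_density) auto
    also have "\<dots> = (\<integral>\<^sup>+\<theta>. ennreal (L \<theta> * L' \<theta>) / ?I \<partial>\<mu>)"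
      using assms(3) by (intro nn_integral_cong_AE)
        (auto simp: divide_ennreal_def ennreal_mult' ac_simps)
    also have "\<dots> = (\<integral>\<^sup>+\<theta>. ennreal (L \<theta> * L' \<theta>) \<partial>\<mu>) / ?I"
      by (rule nn_integral_divide) simp
    finally show ?thesis .
  qed
  have c: "a / ?I * (b / (c / ?I)) = a * b / c" for a b c
    using I divide_mult_eq[of "inverse ?I" "a * b" c]
    by (simp add: ennreal_times_divide divide_ennreal_def ac_simps)
  have "bayes_update (bayes_update \<mu> L) L' = density (density \<mu> (\<lambda>\<theta>. ennreal (L \<theta>) / ?I))
      (\<lambda>\<theta>. ennreal (L' \<theta>) / ((\<integral>\<^sup>+\<theta>. ennreal (L \<theta> * L' \<theta>) \<partial>\<mu>) / ?I))"
    unfolding bayes_update_def[of "bayes_update \<mu> L"] I' by (simp add: bayes_update_def)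
  also have "\<dots> = density \<mu> (\<lambda>\<theta>. ennreal (L \<theta>) / ?I *
      (ennreal (L' \<theta>) / ((\<integral>\<^sup>+\<theta>. ennreal (L \<theta> * L' \<theta>) \<partial>\<mu>) / ?I)))"
    by (rule density_density_eq) auto
  also have "\<dots> = bayes_update \<mu> (\<lambda>\<theta>. L \<theta> * L' \<theta>)"
    unfolding bayes_update_def c using assms(3)
    by (intro density_cong) (auto simp: ennreal_mult')
  finally show ?thesis .
qed

text \<open>Written with \<open>pmf\<close>, this extends the polynomial
  \<open>x ^ K * (1 - x) ^ L\<close> from the unit interval to all reals by clamping
  \<open>x\<close>. It is therefore continuous and at most 1 everywhere, and it is the likelihood
  under \<open>draw_law\<close> even for parameters outside the unit interval.\<close>

definition bernoulli_lik :: "nat \<Rightarrow> nat \<Rightarrow> real \<Rightarrow> real" where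
  "bernoulli_lik K L x = pmf (bernoulli_pmf x) True ^ K * pmf (bernoulli_pmf x) False ^ L"

lemma pmf_bernoulli_pmf:
  "pmf (bernoulli_pmf x) True = min 1 (max 0 x)" "pmf (bernoulli_pmf x) False = 1 - min 1 (max 0 x)"
  by (simp_all add: bernoulli_pmf.rep_eq)

lemma bernoulli_lik_eq: "0 \<le> x \<Longrightarrow> x \<le> 1 \<Longrightarrow> bernoulli_lik K L x = x ^ K * (1 - x) ^ L"
  by (simp add: bernoulli_lik_def)

lemma bernoulli_lik_nonneg [simp]: "0 \<le> bernoulli_lik K L x"
  by (simp add: bernoulli_lik_def)

lemma bernoulli_lik_le_1: "bernoulli_lik K L x \<le> 1"
  by (auto simp: bernoulli_lik_def pmf_le_1 intro!: mult_le_one power_le_one)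

lemma continuous_bernoulli_lik: "continuous_on A (bernoulli_lik K L)"
  unfolding bernoulli_lik_def pmf_bernoulli_pmf by (intro continuous_intros)

lemma borel_measurable_bernoulli_lik [measurable]: "bernoulli_lik K L \<in> borel_measurable borel"
  by (intro borel_measurable_continuous_onI continuous_bernoulli_lik)

lemma prob_space_bayes_update:
  assumes "L \<in> borel_measurable \<mu>"
    and "(\<integral>\<^sup>+\<theta>. ennreal (L \<theta>) \<partial>\<mu>) \<noteq> 0" "(\<integral>\<^sup>+\<theta>. ennreal (L \<theta>) \<partial>\<mu>) \<noteq> \<infinity>"
  shows "prob_space (bayes_update \<mu> L)"
proof
  have "(\<integral>\<^sup>+\<theta>. ennreal (L \<theta>) * indicator (space \<mu>) \<theta> \<partial>\<mu>) = (\<integral>\<^sup>+\<theta>. ennreal (L \<theta>) \<partial>\<mu>)"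
    by (intro nn_integral_cong) simp
  then show "emeasure (bayes_update \<mu> L) (space (bayes_update \<mu> L)) = 1"
    using assms by (simp add: emeasure_bayes_update divide_eq_1_ennreal)
qed

lemma AE_bayes_update:
  assumes "L \<in> borel_measurable \<mu>" "AE \<theta> in \<mu>. P \<theta>"
  shows "AE \<theta> in bayes_update \<mu> L. P \<theta>"
  unfolding bayes_update_def using assms by (subst AE_density) auto

context
  fixes \<mu> :: "real measure" and p :: real
  assumes \<mu>: "real_distribution \<mu>" and unit: "AE x in \<mu>. 0 \<le> x \<and> x \<le> 1"
begin

interpretation real_distribution \<mu> by (rule \<mu>)

lemma emeasure_UNIV_eq_1: "emeasure \<mu> UNIV = 1"
  using emeasure_space_1 by simp

lemma nn_integral_bernoulli_lik_finite: "(\<integral>\<^sup>+x. ennreal (bernoulli_lik K L x) \<partial>\<mu>) \<noteq> \<infinity>"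
proof -
  have "(\<integral>\<^sup>+x. ennreal (bernoulli_lik K L x) \<partial>\<mu>) \<le> (\<integral>\<^sup>+x. 1 \<partial>\<mu>)"
    by (intro nn_integral_mono) (simp add: bernoulli_lik_le_1)
  then show ?thesis by (auto simp: emeasure_UNIV_eq_1 top_unique)
qed

text \<open>Continuity spreads positivity at \<open>p\<close> to a neighbourhood, which has positive
  mass because \<open>p\<close> lies in the support.\<close>

lemma nn_integral_bernoulli_lik_nonzero:
  assumes p: "p \<in> msupport \<mu>" and pos: "0 < bernoulli_lik K L p"
  shows "(\<integral>\<^sup>+x. ennreal (bernoulli_lik K L x) \<partial>\<mu>) \<noteq> 0"
proof
  assume "(\<integral>\<^sup>+x. ennreal (bernoulli_lik K L x) \<partial>\<mu>) = 0"
  then have "AE x in \<mu>. ennreal (bernoulli_lik K L x) = 0"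
    by (subst (asm) nn_integral_0_iff_AE) auto
  then have "AE x in \<mu>. \<not> 0 < bernoulli_lik K L x" by eventually_elim (simp add: ennreal_eq_0_iff)
  then have "emeasure \<mu> {x. 0 < bernoulli_lik K L x} = 0"
    by (subst (asm) AE_iff_measurable[OF _ refl]) auto
  moreover have "open {x. 0 < bernoulli_lik K L x}"
    by (intro open_Collect_less continuous_intros continuous_bernoulli_lik)
  ultimately show False using p pos unfolding msupport_def by fastforce
qed

lemma real_distribution_bernoulli_posterior:
  assumes "(\<integral>\<^sup>+x. ennreal (bernoulli_lik K L x) \<partial>\<mu>) \<noteq> 0"
  shows "real_distribution (bayes_update \<mu> (bernoulli_lik K L))"
  using prob_space_bayes_update[OF _ assms nn_integral_bernoulli_lik_finite]
  by (simp add: real_distribution_def real_distribution_axioms_def)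

text \<open>Integrating the separation bound over bad \<open>x\<close> and over \<open>y\<close>
  near \<open>p\<close> shows that the posterior mass of the bad set times the prior mass near
  \<open>p\<close> is at most \<open>\<rho> ^ (K i + L i)\<close>. The support condition makes the
  second factor positive.\<close>

lemma bernoulli_posterior_concentrates:
  assumes p: "p \<in> msupport \<mu>" "0 \<le> p" "p \<le> 1"
    and lim: "(\<lambda>i. real (K i) / real (K i + L i)) \<longlonglongrightarrow> p"
    and inf: "filterlim (\<lambda>i. K i + L i) at_top sequentially"
    and p0: "p = 0 \<Longrightarrow> \<forall>i. K i = 0" and p1: "p = 1 \<Longrightarrow> \<forall>i. L i = 0"
    and nz: "\<And>i. (\<integral>\<^sup>+x. ennreal (bernoulli_lik (K i) (L i) x) \<partial>\<mu>) \<noteq> 0"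
  shows "concentrates_at (\<lambda>i. bayes_update \<mu> (bernoulli_lik (K i) (L i))) p"
  unfolding concentrates_at_def
proof (intro allI impI)
  fix \<epsilon> :: real assume \<epsilon>: "\<epsilon> > 0"
  obtain \<delta> \<rho> where \<delta>: "\<delta> > 0" and \<rho>: "0 \<le> \<rho>" "\<rho> < 1" and
    sep: "\<forall>\<^sub>F i in sequentially. \<forall>x y. 0 \<le> x \<longrightarrow> x \<le> 1 \<longrightarrow> 0 \<le> y \<longrightarrow> y \<le> 1 \<longrightarrow>
     \<epsilon> < \<bar>x - p\<bar> \<longrightarrow> \<bar>y - p\<bar> < \<delta> \<longrightarrow>
     x ^ K i * (1 - x) ^ L i \<le> \<rho> ^ (K i + L i) * (y ^ K i * (1 - y) ^ L i)"
    using bernoulli_likelihood_separation[OF p(2,3) \<epsilon> lim p0 p1] by blast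
  define near where "near = {y. \<bar>y - p\<bar> < \<delta>}"
  define bad where "bad = {y. \<bar>y - p\<bar> > \<epsilon>}"
  have [measurable]: "near \<in> sets borel" "bad \<in> sets borel" by (simp_all add: near_def bad_def)
  have "open near" unfolding near_def by (intro open_Collect_less continuous_intros)
  then have m: "0 < emeasure \<mu> near"
    using p(1) \<delta> by (auto simp: msupport_def near_def)
  have m': "0 < measure \<mu> near" using m by (simp add: emeasure_eq_measure)
  have ev: "\<forall>\<^sub>F i in sequentially. measure (bayes_update \<mu> (bernoulli_lik (K i) (L i))) bad
      \<le> \<rho> ^ (K i + L i) / measure \<mu> near"
    using sep
  proof eventually_elim
    case (elim i)
    let ?l = "bernoulli_lik (K i) (L i)"
    let ?I = "\<integral>\<^sup>+x. ennreal (?l x) \<partial>\<mu>"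
    let ?B = "\<integral>\<^sup>+x. ennreal (?l x) * indicator bad x \<partial>\<mu>"
    interpret post: prob_space "bayes_update \<mu> ?l"
      using nz[of i] by (intro prob_space_bayes_update nn_integral_bernoulli_lik_finite) auto
    have B: "?B \<le> ennreal (\<rho> ^ (K i + L i) * ?l y)" if y: "y \<in> near" "0 \<le> y" "y \<le> 1" for y
    proof -
      have "?B \<le> (\<integral>\<^sup>+x. ennreal (\<rho> ^ (K i + L i) * ?l y) \<partial>\<mu>)"
        using unit elim y
        by (intro nn_integral_mono_AE)
          (auto simp: indicator_def near_def bad_def bernoulli_lik_eq ennreal_leI)
      then show ?thesis by (simp add: emeasure_UNIV_eq_1)
    qed
    have "?B * emeasure \<mu> near = (\<integral>\<^sup>+y. ?B * indicator near y \<partial>\<mu>)"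
      by (subst nn_integral_cmult_indicator) auto
    also have "\<dots> \<le> (\<integral>\<^sup>+y. ennreal (\<rho> ^ (K i + L i)) * ennreal (?l y) \<partial>\<mu>)"
      using unit B \<rho> by (intro nn_integral_mono_AE) (auto simp: indicator_def ennreal_mult')
    also have "\<dots> = ennreal (\<rho> ^ (K i + L i)) * ?I" by (rule nn_integral_cmult) auto
    finally have "?B * emeasure \<mu> near / ?I \<le> ennreal (\<rho> ^ (K i + L i)) * ?I / ?I"
      by (rule divide_right_mono_ennreal)
    also have "\<dots> = ennreal (\<rho> ^ (K i + L i))"
      using nz[of i] nn_integral_bernoulli_lik_finite[of "K i" "L i"] by (intro mult_divide_eq_ennreal) auto
    also have "?B * emeasure \<mu> near / ?I = emeasure (bayes_update \<mu> ?l) bad * emeasure \<mu> near"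
      by (subst emeasure_bayes_update) (auto simp: divide_ennreal_def ac_simps)
    finally have "measure (bayes_update \<mu> ?l) bad * measure \<mu> near \<le> \<rho> ^ (K i + L i)"
      using \<rho> by (simp add: emeasure_eq_measure post.emeasure_eq_measure flip: ennreal_mult)
    then show ?case using m' by (simp add: field_simps)
  qed
  have lim0: "(\<lambda>i. \<rho> ^ (K i + L i) / measure \<mu> near) \<longlonglongrightarrow> 0"
  proof -
    have "(\<lambda>i. \<rho> ^ (K i + L i)) \<longlonglongrightarrow> 0"
      using filterlim_compose[OF LIMSEQ_realpow_zero[OF \<rho>] inf] .
    then show ?thesis by (rule tendsto_divide_zero)
  qed
  show "(\<lambda>i. measure (bayes_update \<mu> (bernoulli_lik (K i) (L i))) {y. \<epsilon> < \<bar>y - p\<bar>}) \<longlonglongrightarrow> 0"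
    using ev unfolding bad_def[symmetric] by (intro Lim_null_comparison[OF _ lim0]) simp
qed

end

section \<open>Marginals under independent priors\<close>

lemma nn_integral_prod_PiM_pair:
  fixes A B :: "'b::finite \<Rightarrow> real measure" and u v :: "'b \<Rightarrow> real \<Rightarrow> ennreal"
  assumes A: "\<And>k. real_distribution (A k)" and B: "\<And>k. real_distribution (B k)"
    and [measurable]: "\<And>k. u k \<in> borel_measurable borel" "\<And>k. v k \<in> borel_measurable borel"
  shows "(\<integral>\<^sup>+\<theta>. (\<Prod>k\<in>UNIV. u k (fst \<theta> k)) * (\<Prod>k\<in>UNIV. v k (snd \<theta> k)) \<partial>(PiM UNIV A \<Otimes>\<^sub>M PiM UNIV B))
    = (\<Prod>k\<in>UNIV. \<integral>\<^sup>+x. u k x \<partial>A k) * (\<Prod>k\<in>UNIV. \<integral>\<^sup>+x. v k x \<partial>B k)"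
proof -
  interpret A: product_prob_space A UNIV
    using A by (simp add: product_prob_space_def product_sigma_finite_def product_prob_space_axioms_def
        real_distribution_def prob_space_imp_sigma_finite)
  interpret B: product_prob_space B UNIV
    using B by (simp add: product_prob_space_def product_sigma_finite_def product_prob_space_axioms_def
        real_distribution_def prob_space_imp_sigma_finite)
  have [measurable_cong, simp]: "sets (A k) = sets borel" "sets (B k) = sets borel" for k
    using A B by (auto simp: real_distribution_def real_distribution_axioms_def)
  have "(\<integral>\<^sup>+\<theta>. (\<Prod>k\<in>UNIV. u k (fst \<theta> k)) * (\<Prod>k\<in>UNIV. v k (snd \<theta> k)) \<partial>(PiM UNIV A \<Otimes>\<^sub>M PiM UNIV B))
    = (\<integral>\<^sup>+a. \<integral>\<^sup>+b. (\<Prod>k\<in>UNIV. u k (a k)) * (\<Prod>k\<in>UNIV. v k (b k)) \<partial>PiM UNIV B \<partial>PiM UNIV A)"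
    by (subst B.nn_integral_fst[symmetric]) auto
  also have "\<dots> = (\<integral>\<^sup>+a. (\<Prod>k\<in>UNIV. u k (a k)) * (\<integral>\<^sup>+b. (\<Prod>k\<in>UNIV. v k (b k)) \<partial>PiM UNIV B) \<partial>PiM UNIV A)"
    by (intro nn_integral_cong nn_integral_cmult) auto
  also have "\<dots> = (\<integral>\<^sup>+a. (\<Prod>k\<in>UNIV. u k (a k)) \<partial>PiM UNIV A) * (\<integral>\<^sup>+b. (\<Prod>k\<in>UNIV. v k (b k)) \<partial>PiM UNIV B)"
    by (intro nn_integral_multc) auto
  finally show ?thesis
    by (simp add: A.product_nn_integral_prod B.product_nn_integral_prod)
qed

text \<open>A likelihood that is a product over the coordinates preserves independence: an event
  about one coordinate changes one factor only, and all others cancel against the normalising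
  constant.\<close>

lemma
  fixes A B :: "'b::finite \<Rightarrow> real measure" and f g :: "'b \<Rightarrow> real \<Rightarrow> real" and j :: 'b
  assumes A: "\<And>k. real_distribution (A k)" and B: "\<And>k. real_distribution (B k)"
    and [measurable]: "\<And>k. f k \<in> borel_measurable borel" "\<And>k. g k \<in> borel_measurable borel"
    and nonneg: "\<And>k x. 0 \<le> f k x" "\<And>k x. 0 \<le> g k x"
    and I: "\<And>k. (\<integral>\<^sup>+x. f k x \<partial>A k) \<noteq> 0" "\<And>k. (\<integral>\<^sup>+x. f k x \<partial>A k) \<noteq> \<infinity>"
           "\<And>k. (\<integral>\<^sup>+x. g k x \<partial>B k) \<noteq> 0" "\<And>k. (\<integral>\<^sup>+x. g k x \<partial>B k) \<noteq> \<infinity>"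
  defines "\<mu> \<equiv> bayes_update (PiM UNIV A \<Otimes>\<^sub>M PiM UNIV B)
      (\<lambda>\<theta>. (\<Prod>k\<in>UNIV. f k (fst \<theta> k)) * (\<Prod>k\<in>UNIV. g k (snd \<theta> k)))"
  shows fit_marginal_bayes_update: "fit_marginal \<mu> j = bayes_update (A j) (f j)"
    and qual_marginal_bayes_update: "qual_marginal \<mu> j = bayes_update (B j) (g j)"
    and nn_integral_lik_nonzero: "(\<integral>\<^sup>+\<theta>. ennreal ((\<Prod>k\<in>UNIV. f k (fst \<theta> k)) * (\<Prod>k\<in>UNIV. g k (snd \<theta> k)))
           \<partial>(PiM UNIV A \<Otimes>\<^sub>M PiM UNIV B)) \<noteq> 0"
    and nn_integral_lik_finite: "(\<integral>\<^sup>+\<theta>. ennreal ((\<Prod>k\<in>UNIV. f k (fst \<theta> k)) * (\<Prod>k\<in>UNIV. g k (snd \<theta> k)))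
           \<partial>(PiM UNIV A \<Otimes>\<^sub>M PiM UNIV B)) \<noteq> \<infinity>"
proof -
  let ?P = "PiM UNIV A \<Otimes>\<^sub>M PiM UNIV B"
  let ?L = "\<lambda>\<theta>. (\<Prod>k\<in>UNIV. f k (fst \<theta> k)) * (\<Prod>k\<in>UNIV. g k (snd \<theta> k))"
  have [measurable_cong, simp]: "sets (A k) = sets borel" "sets (B k) = sets borel" for k
    using A B by (auto simp: real_distribution_def real_distribution_axioms_def)
  have [simp]: "space (A k) = UNIV" "space (B k) = UNIV" for k
    using sets_eq_imp_space_eq[of "A k" borel] sets_eq_imp_space_eq[of "B k" borel] by auto
  have [measurable]: "?L \<in> borel_measurable ?P" by measurable
  have L: "ennreal (?L \<theta>) = (\<Prod>k\<in>UNIV. ennreal (f k (fst \<theta> k))) * (\<Prod>k\<in>UNIV. ennreal (g k (snd \<theta> k)))" for \<theta>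
    using nonneg by (simp add: ennreal_mult prod_nonneg prod_ennreal)
  have tot: "(\<integral>\<^sup>+\<theta>. ennreal (?L \<theta>) \<partial>?P) = (\<Prod>k\<in>UNIV. \<integral>\<^sup>+x. f k x \<partial>A k) * (\<Prod>k\<in>UNIV. \<integral>\<^sup>+x. g k x \<partial>B k)"
    unfolding L by (intro nn_integral_prod_PiM_pair A B) auto
  show "(\<integral>\<^sup>+\<theta>. ennreal (?L \<theta>) \<partial>?P) \<noteq> 0" using I unfolding tot by auto
  show "(\<integral>\<^sup>+\<theta>. ennreal (?L \<theta>) \<partial>?P) \<noteq> \<infinity>"
    using I unfolding tot by (auto simp: ennreal_mult_eq_top_iff ennreal_prod_eq_top)
  have split: "(\<Prod>k\<in>UNIV. w k) = (\<Prod>k\<in>UNIV - {j}. w k) * w j" for w :: "'b \<Rightarrow> ennreal"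
    by (simp add: prod.remove[of UNIV j] mult.commute)
  show "fit_marginal \<mu> j = bayes_update (A j) (f j)"
  proof (rule measure_eqI)
    fix X assume "X \<in> sets (fit_marginal \<mu> j)"
    then have X [measurable]: "X \<in> sets borel" by (simp add: fit_marginal_def)
    have "(\<lambda>\<theta>. fst \<theta> j) \<in> borel_measurable ?P" by measurable
    then have "(\<lambda>\<theta>. fst \<theta> j) \<in> borel_measurable \<mu>"
      unfolding \<mu>_def by (subst measurable_cong_sets[OF sets_bayes_update refl])
    then have "emeasure (fit_marginal \<mu> j) X = emeasure \<mu> ((\<lambda>\<theta>. fst \<theta> j) -` X \<inter> space ?P)"
      unfolding fit_marginal_def by (subst emeasure_distr) (auto simp: \<mu>_def)
    also have "\<dots> = (\<integral>\<^sup>+\<theta>. ennreal (?L \<theta>) * indicator ((\<lambda>\<theta>. fst \<theta> j) -` X \<inter> space ?P) \<theta> \<partial>?P)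
        / (\<integral>\<^sup>+\<theta>. ennreal (?L \<theta>) \<partial>?P)"
      unfolding \<mu>_def by (subst emeasure_bayes_update) auto
    \<comment> \<open>The indicator is absorbed into the \<open>j\<close>-th factor, so that the
      integrand is again a product over the coordinates.\<close>
    also have "(\<integral>\<^sup>+\<theta>. ennreal (?L \<theta>) * indicator ((\<lambda>\<theta>. fst \<theta> j) -` X \<inter> space ?P) \<theta> \<partial>?P)
       = (\<integral>\<^sup>+\<theta>. (\<Prod>k\<in>UNIV. ennreal (f k (fst \<theta> k)) * (if k = j then indicator X (fst \<theta> k) else 1)) *
          (\<Prod>k\<in>UNIV. ennreal (g k (snd \<theta> k))) \<partial>?P)"
      unfolding L
      by (intro nn_integral_cong) (auto simp: prod.distrib indicator_def prod.If_cases ac_simps)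
    also have "\<dots> = (\<Prod>k\<in>UNIV. \<integral>\<^sup>+x. ennreal (f k x) * (if k = j then indicator X x else 1) \<partial>A k)
        * (\<Prod>k\<in>UNIV. \<integral>\<^sup>+x. g k x \<partial>B k)"
      by (intro nn_integral_prod_PiM_pair A B) auto
    also have "\<dots> / (\<integral>\<^sup>+\<theta>. ennreal (?L \<theta>) \<partial>?P)
        = (\<integral>\<^sup>+x. ennreal (f j x) * indicator X x \<partial>A j) *
           ((\<Prod>k\<in>UNIV - {j}. \<integral>\<^sup>+x. f k x \<partial>A k) * (\<Prod>k\<in>UNIV. \<integral>\<^sup>+x. g k x \<partial>B k)) /
          ((\<integral>\<^sup>+x. f j x \<partial>A j) * ((\<Prod>k\<in>UNIV - {j}. \<integral>\<^sup>+x. f k x \<partial>A k) * (\<Prod>k\<in>UNIV. \<integral>\<^sup>+x. g k x \<partial>B k)))"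
      unfolding tot split[of "\<lambda>k. integral\<^sup>N (A k) (h k)" for h] by (simp add: ac_simps)
    also have "\<dots> = (\<integral>\<^sup>+x. ennreal (f j x) * indicator X x \<partial>A j) / (\<integral>\<^sup>+x. f j x \<partial>A j)"
      using I by (intro divide_mult_eq) (auto simp: ennreal_mult_eq_top_iff ennreal_prod_eq_top)
    also have "\<dots> = emeasure (bayes_update (A j) (f j)) X"
      by (subst emeasure_bayes_update) auto
    finally show "emeasure (fit_marginal \<mu> j) X = emeasure (bayes_update (A j) (f j)) X" .
  qed (simp add: fit_marginal_def)
  show "qual_marginal \<mu> j = bayes_update (B j) (g j)"
  proof (rule measure_eqI)
    fix X assume "X \<in> sets (qual_marginal \<mu> j)"
    then have X [measurable]: "X \<in> sets borel" by (simp add: qual_marginal_def)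
    have "(\<lambda>\<theta>. snd \<theta> j) \<in> borel_measurable ?P" by measurable
    then have "(\<lambda>\<theta>. snd \<theta> j) \<in> borel_measurable \<mu>"
      unfolding \<mu>_def by (subst measurable_cong_sets[OF sets_bayes_update refl])
    then have "emeasure (qual_marginal \<mu> j) X = emeasure \<mu> ((\<lambda>\<theta>. snd \<theta> j) -` X \<inter> space ?P)"
      unfolding qual_marginal_def by (subst emeasure_distr) (auto simp: \<mu>_def)
    also have "\<dots> = (\<integral>\<^sup>+\<theta>. ennreal (?L \<theta>) * indicator ((\<lambda>\<theta>. snd \<theta> j) -` X \<inter> space ?P) \<theta> \<partial>?P)
        / (\<integral>\<^sup>+\<theta>. ennreal (?L \<theta>) \<partial>?P)"
      unfolding \<mu>_def by (subst emeasure_bayes_update) auto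
    also have "(\<integral>\<^sup>+\<theta>. ennreal (?L \<theta>) * indicator ((\<lambda>\<theta>. snd \<theta> j) -` X \<inter> space ?P) \<theta> \<partial>?P)
       = (\<integral>\<^sup>+\<theta>. (\<Prod>k\<in>UNIV. ennreal (f k (fst \<theta> k))) *
          (\<Prod>k\<in>UNIV. ennreal (g k (snd \<theta> k)) * (if k = j then indicator X (snd \<theta> k) else 1)) \<partial>?P)"
      unfolding L
      by (intro nn_integral_cong) (auto simp: prod.distrib indicator_def prod.If_cases ac_simps)
    also have "\<dots> = (\<Prod>k\<in>UNIV. \<integral>\<^sup>+x. f k x \<partial>A k) *
        (\<Prod>k\<in>UNIV. \<integral>\<^sup>+x. ennreal (g k x) * (if k = j then indicator X x else 1) \<partial>B k)"
      by (intro nn_integral_prod_PiM_pair A B) auto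
    also have "\<dots> / (\<integral>\<^sup>+\<theta>. ennreal (?L \<theta>) \<partial>?P)
        = (\<integral>\<^sup>+x. ennreal (g j x) * indicator X x \<partial>B j) *
           ((\<Prod>k\<in>UNIV - {j}. \<integral>\<^sup>+x. g k x \<partial>B k) * (\<Prod>k\<in>UNIV. \<integral>\<^sup>+x. f k x \<partial>A k)) /
          ((\<integral>\<^sup>+x. g j x \<partial>B j) * ((\<Prod>k\<in>UNIV - {j}. \<integral>\<^sup>+x. g k x \<partial>B k) * (\<Prod>k\<in>UNIV. \<integral>\<^sup>+x. f k x \<partial>A k)))"
      unfolding tot split[of "\<lambda>k. integral\<^sup>N (B k) (h k)" for h] by (simp add: ac_simps)
    also have "\<dots> = (\<integral>\<^sup>+x. ennreal (g j x) * indicator X x \<partial>B j) / (\<integral>\<^sup>+x. g j x \<partial>B j)"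
      using I by (intro divide_mult_eq) (auto simp: ennreal_mult_eq_top_iff ennreal_prod_eq_top)
    also have "\<dots> = emeasure (bayes_update (B j) (g j)) X"
      by (subst emeasure_bayes_update) auto
    finally show "emeasure (qual_marginal \<mu> j) X = emeasure (bayes_update (B j) (g j)) X" .
  qed (simp add: qual_marginal_def)
qed

section \<open>Likelihood of a round and form of the beliefs\<close>

text \<open>The value of a consumer affects her record only through her inspection plan, a list over
  a finite type. With the plan as an argument everything here is discrete.\<close>

definition plan_record :: "('b \<Rightarrow> real) \<Rightarrow> 'b list \<Rightarrow> ('b \<Rightarrow> bool) \<Rightarrow> ('b \<Rightarrow> bool) \<Rightarrow> 'b round_record" where
  "plan_record p xs F q = Round p (\<lambda>j. if j \<in> set (inspections F xs) then Some (F j) else None)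
     (map_option (\<lambda>j. (j, q j)) (find F xs))"

text \<open>Gives qualities the same shape as \<open>fits\<close>, an optional Boolean per business,
  so that one theory of trials serves both.\<close>

definition sale_obs :: "'b round_record \<Rightarrow> 'b \<Rightarrow> bool option" where
  "sale_obs r j = (case sale r of None \<Rightarrow> None | Some (k, b) \<Rightarrow> if k = j then Some b else None)"

lemma play_eq: "play c ts \<pi>h Qh p d = plan_record p (plan c ts \<pi>h Qh p (fst d)) (fst (snd d)) (snd (snd d))"
  by (cases d) (simp add: play_def plan_record_def Let_def)

lemma inspections_simps [simp]:
  "inspections F [] = []"
  "inspections F (x # xs) = (if F x then [x] else x # inspections F xs)"
  by (simp_all add: inspections_def)

lemma inspections_cong:
  assumes "\<forall>k\<in>set (inspections F xs). F k = G k"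
  shows "inspections G xs = inspections F xs" "find G xs = find F xs"
  using assms by (induction xs) (auto split: if_splits)

text \<open>The fit of \<open>j\<close> only decides whether the search goes on after
  \<open>j\<close>. This is the predictability that makes the observed fits of \<open>j\<close>
  unbiased trials.\<close>

lemma mem_inspections_upd: "j \<in> set (inspections (F(j := b)) xs) \<longleftrightarrow> j \<in> set (inspections F xs)"
  by (induction xs) auto

lemma find_eq_Some_iff_inspected: "find F xs = Some j \<longleftrightarrow> j \<in> set (inspections F xs) \<and> F j"
  by (induction xs) auto

lemma inspected_if_no_other_fit:
  assumes "\<forall>k. k \<noteq> j \<longrightarrow> \<not> F k" "j \<in> set xs"
  shows "j \<in> set (inspections F xs)"
  using assms(2) by (induction xs) (use assms(1) in auto)

lemma fits_plan_record:
  "fits (plan_record p xs F q) j = (if j \<in> set (inspections F xs) then Some (F j) else None)"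
  by (simp add: plan_record_def)

lemma sale_obs_plan_record:
  "sale_obs (plan_record p xs F q) j = (if j \<in> set (inspections F xs) \<and> F j then Some (q j) else None)"
  by (cases "find F xs")
    (auto simp: plan_record_def sale_obs_def find_eq_Some_iff_inspected[symmetric])

lemma prices_plan_record [simp]: "prices (plan_record p xs F q) = p"
  by (simp add: plan_record_def)

text \<open>Turns the event of producing \<open>r\<close> into a rectangle: a condition on the plan,
  one on each fit and one on each quality. The observed fits already determine how far the search
  goes and what is sold, so coordinates that are not observed are left free.\<close>

lemma plan_record_eq_iff:
  "plan_record p xs F q = r \<longleftrightarrow> (\<exists>F' q'. plan_record p xs F' q' = r) \<and>
     (\<forall>k. fits r k \<in> {None, Some (F k)}) \<and> (\<forall>k. sale_obs r k \<in> {None, Some (q k)})"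
    (is "?l \<longleftrightarrow> ?r")
proof
  assume ?l
  then show ?r by (auto simp: fits_plan_record sale_obs_plan_record)
next
  assume ?r
  then obtain F' q' where r: "r = plan_record p xs F' q'" by auto
  have obs: "\<forall>k. fits r k \<in> {None, Some (F k)}" "\<forall>k. sale_obs r k \<in> {None, Some (q k)}"
    using \<open>?r\<close> by simp_all
  have F: "\<forall>k\<in>set (inspections F' xs). F' k = F k"
  proof
    fix k assume "k \<in> set (inspections F' xs)"
    then have "fits r k = Some (F' k)" by (simp add: r fits_plan_record)
    moreover have "fits r k \<in> {None, Some (F k)}" using obs by blast
    ultimately show "F' k = F k" by simp
  qed
  note eq = inspections_cong[OF F]
  have "q k = q' k" if "find F' xs = Some k" for k
  proof -
    have "sale_obs r k = Some (q' k)"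
      using that by (simp add: r sale_obs_plan_record find_eq_Some_iff_inspected)
    moreover have "sale_obs r k \<in> {None, Some (q k)}" using obs by blast
    ultimately show ?thesis by simp
  qed
  then have "map_option (\<lambda>j. (j, q j)) (find F xs) = map_option (\<lambda>j. (j, q' j)) (find F' xs)"
    unfolding eq by (cases "find F' xs") auto
  then show ?l using F by (auto simp: r plan_record_def eq fun_eq_iff)
qed

section \<open>Measurability of the inspection plan, and products of Bernoulli laws\<close>

lemma measurable_insort_key [measurable]:
  fixes f :: "'b::countable \<Rightarrow> 'a \<Rightarrow> real"
  assumes [measurable]: "\<And>k. f k \<in> borel_measurable N"
  shows "(\<lambda>v. insort_key (\<lambda>k. f k v) x ys) \<in> N \<rightarrow>\<^sub>M count_space UNIV"
proof (induction ys)
  case (Cons y ys)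
  have cons: "(\<lambda>v. y # insort_key (\<lambda>k. f k v) x ys) \<in> N \<rightarrow>\<^sub>M count_space UNIV"
    using measurable_compose[OF Cons.IH, of "(#) y" "count_space UNIV"] by simp
  have "(\<lambda>v. if f x v \<le> f y v then x # y # ys else y # insort_key (\<lambda>k. f k v) x ys) \<in> N \<rightarrow>\<^sub>M count_space UNIV"
    by (intro measurable_If cons) measurable
  then show ?case by simp
qed simp

lemma measurable_sort_key [measurable]:
  fixes f :: "'b::countable \<Rightarrow> 'a \<Rightarrow> real"
  assumes [measurable]: "\<And>k. f k \<in> borel_measurable N"
  shows "(\<lambda>v. sort_key (\<lambda>k. f k v) xs) \<in> N \<rightarrow>\<^sub>M count_space UNIV"
proof (induction xs)
  case (Cons x xs)
  have "(\<lambda>v. insort_key (\<lambda>k. f k v) x (sort_key (\<lambda>k. f k v) xs)) \<in> N \<rightarrow>\<^sub>M count_space UNIV"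
    by (rule measurable_compose_countable[OF measurable_insort_key Cons.IH]) measurable
  then show ?case by simp
qed simp

lemma measurable_filter [measurable]:
  assumes [measurable]: "\<And>k. Measurable.pred N (P k)"
  shows "(\<lambda>v. filter (\<lambda>k. P k v) xs) \<in> N \<rightarrow>\<^sub>M count_space UNIV"
proof (induction xs)
  case (Cons x xs)
  have cons: "(\<lambda>v. x # filter (\<lambda>k. P k v) xs) \<in> N \<rightarrow>\<^sub>M count_space UNIV"
    using measurable_compose[OF Cons.IH, of "(#) x" "count_space UNIV"] by simp
  have "(\<lambda>v. if P x v then x # filter (\<lambda>k. P k v) xs else filter (\<lambda>k. P k v) xs) \<in> N \<rightarrow>\<^sub>M count_space UNIV"
    by (intro measurable_If Cons.IH cons) measurable
  then show ?case by simp
qed simp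

lemma measurable_plan:
  fixes ts :: "'b::finite list"
  shows "plan c ts \<pi>h Qh p \<in> borel \<rightarrow>\<^sub>M count_space UNIV"
proof -
  have [measurable]: "(\<lambda>v. sigma_index c (p k) (\<pi>h k) (Qh k) v) \<in> borel_measurable borel" for k
    unfolding sigma_index_def by measurable
  have "(\<lambda>v. sort_key (\<lambda>j. - sigma_index c (p j) (\<pi>h j) (Qh j) v)
      (filter (\<lambda>j. sigma_index c (p j) (\<pi>h j) (Qh j) v > 0) ts)) \<in> borel \<rightarrow>\<^sub>M count_space UNIV"
    by (rule measurable_compose_countable[OF measurable_sort_key]) measurable
  then show ?thesis by (simp add: plan_def[abs_def] Let_def)
qed

abbreviation bernoulli_PiM :: "('b \<Rightarrow> real) \<Rightarrow> ('b \<Rightarrow> bool) measure" where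
  "bernoulli_PiM \<pi> \<equiv> \<Pi>\<^sub>M j\<in>UNIV. measure_pmf (bernoulli_pmf (\<pi> j))"

lemma space_bernoulli_PiM [simp]: "space (bernoulli_PiM \<pi>) = UNIV"
  by (simp add: space_PiM)

lemma measurable_bernoulli_PiM_count_space [measurable]:
  "(\<lambda>F. F) \<in> bernoulli_PiM (\<pi> :: 'b::finite \<Rightarrow> real) \<rightarrow>\<^sub>M count_space UNIV"
proof (subst measurable_count_space_eq_countable, safe)
  fix F0 :: "'b \<Rightarrow> bool"
  have "(\<lambda>F. F) -` {F0} \<inter> space (bernoulli_PiM \<pi>) = Pi\<^sub>E UNIV (\<lambda>k. {F0 k})"
    by (auto simp: PiE_iff fun_eq_iff)
  also have "\<dots> \<in> sets (bernoulli_PiM \<pi>)" by (intro sets_PiM_I_finite) auto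
  finally show "(\<lambda>F. F) -` {F0} \<inter> space (bernoulli_PiM \<pi>) \<in> sets (bernoulli_PiM \<pi>)" .
qed auto

lemma prob_space_bernoulli_PiM: "prob_space (bernoulli_PiM \<pi>)"
  by (intro prob_space_PiM measure_pmf.prob_space_axioms)

lemma product_prob_space_bernoulli:
  "product_prob_space (\<lambda>j. measure_pmf (bernoulli_pmf (\<pi> j)))"
  by (simp add: product_prob_space_def product_sigma_finite_def product_prob_space_axioms_def
      measure_pmf.prob_space_axioms measure_pmf.sigma_finite_measure_axioms)

lemma ennreal_convex_same: "0 \<le> p \<Longrightarrow> p \<le> 1 \<Longrightarrow> ennreal p * x + ennreal (1 - p) * x = x"
  by (simp add: distrib_right[symmetric] flip: ennreal_plus)

text \<open>Redraws coordinate \<open>j\<close>. The right side remains an integral over all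
  coordinates, with the old \<open>j\<close>-th one overwritten, so that it can be compared
  pointwise with integrands that ignore this coordinate.\<close>

lemma nn_integral_bernoulli_PiM_resample:
  fixes f :: "('b::finite \<Rightarrow> bool) \<Rightarrow> ennreal" and j :: 'b
  assumes \<pi>: "0 \<le> \<pi> j" "\<pi> j \<le> 1"
  shows "(\<integral>\<^sup>+F. f F \<partial>bernoulli_PiM \<pi>)
    = (\<integral>\<^sup>+F. ennreal (\<pi> j) * f (F(j := True)) + ennreal (1 - \<pi> j) * f (F(j := False)) \<partial>bernoulli_PiM \<pi>)"
proof -
  interpret product_prob_space "\<lambda>j. measure_pmf (bernoulli_pmf (\<pi> j))" UNIV
    by (rule product_prob_space_bernoulli)
  have meas: "g \<in> borel_measurable (bernoulli_PiM \<pi>)" for g :: "('b \<Rightarrow> bool) \<Rightarrow> ennreal"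
    using measurable_compose[OF measurable_bernoulli_PiM_count_space, of g] by simp
  have bern: "(\<integral>\<^sup>+b. h b \<partial>bernoulli_pmf (\<pi> j)) = ennreal (\<pi> j) * h True + ennreal (1 - \<pi> j) * h False"
    for h :: "bool \<Rightarrow> ennreal"
    using \<pi> by (subst nn_integral_measure_pmf_support[of UNIV]) (auto simp: UNIV_bool mult.commute add.commute)
  let ?P = "\<Pi>\<^sub>M k\<in>UNIV - {j}. measure_pmf (bernoulli_pmf (\<pi> k))"
  have *: "(\<integral>\<^sup>+F. g F \<partial>bernoulli_PiM \<pi>)
      = (\<integral>\<^sup>+F. ennreal (\<pi> j) * g (F(j := True)) + ennreal (1 - \<pi> j) * g (F(j := False)) \<partial>?P)"
    for g :: "('b \<Rightarrow> bool) \<Rightarrow> ennreal"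
  proof -
    have "(\<integral>\<^sup>+F. g F \<partial>bernoulli_PiM \<pi>)
        = (\<integral>\<^sup>+F. \<integral>\<^sup>+b. g (F(j := b)) \<partial>bernoulli_pmf (\<pi> j) \<partial>?P)"
      using product_nn_integral_insert[of "UNIV - {j}" j g] meas[of g] by (simp add: insert_absorb)
    then show ?thesis unfolding bern .
  qed
  show ?thesis by (subst (1 2) *) (simp add: ennreal_convex_same \<pi>)
qed

lemma AE_singleton_pos:
  assumes "g \<in> N \<rightarrow>\<^sub>M count_space UNIV" "countable (range g)"
  shows "AE d in N. emeasure N {e \<in> space N. g e = g d} > 0"
proof -
  have "AE d in N. \<forall>r\<in>range g. g d = r \<longrightarrow> emeasure N {e \<in> space N. g e = r} > 0"
    using assms(2)
  proof (subst AE_ball_countable, safe)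
    fix x
    show "AE d in N. g d = g x \<longrightarrow> 0 < emeasure N {e \<in> space N. g e = g x}"
    proof (cases "emeasure N {e \<in> space N. g e = g x} = 0")
      case True
      have "{e \<in> space N. g e = g x} = g -` {g x} \<inter> space N" by auto
      then have "{e \<in> space N. g e = g x} \<in> sets N"
        using assms(1) by (auto intro: measurable_sets)
      with True have "AE d in N. \<not> g d = g x" by (intro AE_I'[of "{e \<in> space N. g e = g x}"]) (auto simp: null_sets_def)
      then show ?thesis by eventually_elim auto
    qed (auto simp: zero_less_iff_neq_zero)
  qed
  then show ?thesis by eventually_elim auto
qed

section \<open>Observation counts, exponential tilting and multiplicative weights\<close>

definition option_lik :: "bool option \<Rightarrow> real \<Rightarrow> real" where
  "option_lik u x = (case u of None \<Rightarrow> 1 | Some b \<Rightarrow> pmf (bernoulli_pmf x) b)"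

lemma option_lik_nonneg [simp]: "0 \<le> option_lik u x"
  by (simp add: option_lik_def split: option.split)

definition count_obs :: "('r \<Rightarrow> bool option) \<Rightarrow> bool \<Rightarrow> 'r list \<Rightarrow> nat" where
  "count_obs f b H = length (filter (\<lambda>r. f r = Some b) H)"

lemma count_obs_simps [simp]:
  "count_obs f b [] = 0"
  "count_obs f b (r # H) = (if f r = Some b then 1 else 0) + count_obs f b H"
  by (simp_all add: count_obs_def)

abbreviation history_lik :: "('r \<Rightarrow> bool option) \<Rightarrow> 'r list \<Rightarrow> real \<Rightarrow> real" where
  "history_lik f H \<equiv> bernoulli_lik (count_obs f True H) (count_obs f False H)"

lemma history_lik_Cons: "history_lik f (r # H) x = option_lik (f r) x * history_lik f H x"
  by (cases "f r") (auto simp: bernoulli_lik_def option_lik_def)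

lemma bernoulli_lik_0 [simp]: "bernoulli_lik 0 0 x = 1"
  by (simp add: bernoulli_lik_def)

lemma measurable_bernoulli_pair:
  "f \<in> bernoulli_PiM (\<pi> :: 'b::finite \<Rightarrow> real) \<Otimes>\<^sub>M bernoulli_PiM (\<rho> :: 'b \<Rightarrow> real) \<rightarrow>\<^sub>M count_space UNIV"
proof -
  have "(\<lambda>x. (fst x, snd x)) \<in> bernoulli_PiM \<pi> \<Otimes>\<^sub>M bernoulli_PiM \<rho> \<rightarrow>\<^sub>M count_space UNIV \<Otimes>\<^sub>M count_space UNIV"
    by measurable
  then have "(\<lambda>x. x) \<in> bernoulli_PiM \<pi> \<Otimes>\<^sub>M bernoulli_PiM \<rho> \<rightarrow>\<^sub>M count_space UNIV"
    by (simp add: pair_measure_countable)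
  from measurable_compose[OF this, of f "count_space UNIV"] show ?thesis by simp
qed

lemma measurable_bernoulli_PiM:
  "f \<in> bernoulli_PiM (\<pi> :: 'b::finite \<Rightarrow> real) \<rightarrow>\<^sub>M count_space UNIV"
  using measurable_compose[OF measurable_bernoulli_PiM_count_space, of f "count_space UNIV"] by simp

lemma measurable_count_space_imp_borel: "f \<in> N \<rightarrow>\<^sub>M count_space UNIV \<Longrightarrow> f \<in> N \<rightarrow>\<^sub>M borel"
  using measurable_compose[of f N "count_space UNIV" "\<lambda>x. x" borel] by simp

lemma weak_conv_eventually_const:
  assumes "\<And>n. n0 \<le> n \<Longrightarrow> \<mu> n = \<nu>"
  shows "weak_conv_m \<mu> \<nu>"
  unfolding weak_conv_m_def weak_conv_def
  using assms by (auto intro!: tendsto_eventually eventually_sequentiallyI[of n0])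

lemma count_obs_Not:
  "count_obs (\<lambda>r. map_option Not (f r)) b H = count_obs f (\<not> b) H"
proof -
  have "map_option Not (f r) = Some b \<longleftrightarrow> f r = Some (\<not> b)" for r by (cases "f r") auto
  then show ?thesis by (simp add: count_obs_def)
qed

lemma suminf_ennreal_eq_top:
  fixes t :: "nat \<Rightarrow> ennreal" and c :: real
  assumes inf: "infinite {n. ennreal c \<le> t n}" and c: "0 < c"
  shows "(\<Sum>n. t n) = \<top>"
proof (rule ccontr)
  assume "(\<Sum>n. t n) \<noteq> \<top>"
  then obtain x where x: "0 \<le> x" "(\<Sum>n. t n) = ennreal x" by (cases "\<Sum>n. t n") auto
  obtain m :: nat where m: "x / c < real m" using reals_Archimedean2 by blast
  obtain B where B: "finite B" "card B = m" "B \<subseteq> {n. ennreal c \<le> t n}"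
    using infinite_arbitrarily_large[OF inf] by blast
  have "ennreal (real m * c) = (\<Sum>n\<in>B. ennreal c)"
    using B(2) c by (simp add: ennreal_of_nat_eq_real_of_nat ennreal_mult)
  also have "\<dots> \<le> (\<Sum>n\<in>B. t n)" using B(3) by (intro sum_mono) auto
  also have "\<dots> \<le> (\<Sum>n. t n)" by (rule sum_le_suminf) (use B(1) in auto)
  finally have "real m * c \<le> x" using x by (simp add: ennreal_le_iff)
  then show False using m c by (simp add: field_simps)
qed

text \<open>For a probability \<open>p\<close> this is the moment generating function of a Bernoulli
  variable minus \<open>p + \<epsilon>\<close>. It is 1 at \<open>h = 0\<close> with slope
  \<open>- \<epsilon>\<close>, hence falls below 1 just to the right of 0.\<close>

lemma exponential_tilt_less_1:
  fixes p \<epsilon> :: real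
  assumes "0 < \<epsilon>"
  shows "\<exists>h>0. p * exp (h * (1 - (p + \<epsilon>))) + (1 - p) * exp (- (h * (p + \<epsilon>))) < 1"
proof -
  define \<phi> where "\<phi> h = p * exp (h * (1 - (p + \<epsilon>))) + (1 - p) * exp (- (h * (p + \<epsilon>)))" for h
  have "(\<phi> has_real_derivative - \<epsilon>) (at 0)"
    unfolding \<phi>_def by (auto intro!: derivative_eq_intros simp: algebra_simps)
  from DERIV_neg_dec_right[OF this] assms
  obtain d where d: "d > 0" "\<And>h. 0 < h \<Longrightarrow> h < d \<Longrightarrow> \<phi> (0 + h) < \<phi> 0" by auto
  have "\<phi> (d / 2) < 1" using d(2)[of "d / 2"] d(1) by (simp add: \<phi>_def)
  then show ?thesis using d(1) unfolding \<phi>_def by (intro exI[of _ "d / 2"]) auto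
qed

text \<open>The multiplicative functional of the history; the factor for a record may depend on the
  history before it.\<close>

primrec weight_prod :: "('r list \<Rightarrow> 'r \<Rightarrow> ennreal) \<Rightarrow> 'r list \<Rightarrow> ennreal" where
  "weight_prod w [] = 1"
| "weight_prod w (r # H) = w H r * weight_prod w H"

section \<open>The market with fixed seeds\<close>

locale market_run =
  fixes M :: "('b::finite, 's) market" and s :: "nat \<Rightarrow> 'b \<Rightarrow> 's"
  assumes valid: "valid_market M"
begin

abbreviation fit_mean :: "'b history \<Rightarrow> 'b \<Rightarrow> real" where
  "fit_mean H k \<equiv> mean (beliefF M H k)"

abbreviation qual_mean :: "'b history \<Rightarrow> 'b \<Rightarrow> real" where
  "qual_mean H k \<equiv> mean (beliefQ M H k)"

text \<open>The round number is recovered as the length of the history, so the seed of the round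
  needs no separate argument and a round is a function of the history and one draw.\<close>

definition posted :: "'b history \<Rightarrow> 'b \<Rightarrow> real" where
  "posted H k = price M k H (s (length H) k)"

definition next_record :: "'b history \<Rightarrow> 'b draw \<Rightarrow> 'b round_record" where
  "next_record H = play (cost M) (tie M H) (fit_mean H) (qual_mean H) (posted H)"

abbreviation truth :: "'b draw measure" where
  "truth \<equiv> draw_law M (fit M, qual M)"

lemma fit_bounds: "0 < fit M k" "fit M k < 1"
  and qual_bounds: "0 \<le> qual M k" "qual M k \<le> 1"
  and prior: "real_distribution (priorF M k)" "real_distribution (priorQ M k)"
  and prior_unit: "AE x in priorF M k. 0 < x \<and> x < 1" "AE x in priorQ M k. 0 \<le> x \<and> x \<le> 1"
  and support: "fit M k \<in> msupport (priorF M k)" "qual M k \<in> msupport (priorQ M k)"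
  using valid by (auto simp: valid_market_def)

lemma prior_unitF: "AE x in priorF M k. 0 \<le> x \<and> x \<le> 1"
  using prior_unit(1)[of k] by eventually_elim auto

sublocale V: prob_space "value_law M"
  using valid by (simp add: valid_market_def)

lemma sets_value_law [measurable_cong, simp]: "sets (value_law M) = sets borel"
  by (simp add: value_law_def)

lemma space_value_law [simp]: "space (value_law M) = UNIV"
  by (simp add: value_law_def)

lemma draw_law_eq: "draw_law M \<theta> = value_law M \<Otimes>\<^sub>M (bernoulli_PiM (fst \<theta>) \<Otimes>\<^sub>M bernoulli_PiM (snd \<theta>))"
  by (simp add: draw_law_def split: prod.split)

lemma space_draw_law [simp]: "space (draw_law M \<theta>) = UNIV"
  by (simp add: draw_law_eq space_pair_measure)

lemma prob_space_draw_law: "prob_space (draw_law M \<theta>)"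
  unfolding draw_law_eq
  by (intro prob_space_pair V.prob_space_axioms prob_space_bernoulli_PiM)

lemma measurable_draw:
  fixes ts :: "'b list"
  shows "(\<lambda>d. g (plan c ts \<pi>h Qh p (fst d)) (fst (snd d)) (snd (snd d))) \<in> draw_law M \<theta> \<rightarrow>\<^sub>M count_space UNIV"
proof -
  note [measurable] = measurable_plan[of c ts \<pi>h Qh p]
  have "(\<lambda>d. (plan c ts \<pi>h Qh p (fst d), fst (snd d), snd (snd d)))
      \<in> draw_law M \<theta> \<rightarrow>\<^sub>M count_space UNIV \<Otimes>\<^sub>M (count_space UNIV \<Otimes>\<^sub>M count_space UNIV)"
    unfolding draw_law_eq by measurable
  then have "(\<lambda>d. (plan c ts \<pi>h Qh p (fst d), fst (snd d), snd (snd d)))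
      \<in> draw_law M \<theta> \<rightarrow>\<^sub>M count_space UNIV"
    by (simp add: pair_measure_countable)
  from measurable_compose[OF this, of "\<lambda>(xs, F, q). g xs F q" "count_space UNIV"]
  show ?thesis by (simp add: case_prod_beta)
qed

lemma measurable_play: "play c ts \<pi>h Qh p \<in> draw_law M \<theta> \<rightarrow>\<^sub>M count_space UNIV"
  unfolding play_eq[abs_def] by (rule measurable_draw)

lemma measurable_next_record [measurable]: "next_record H \<in> draw_law M \<theta> \<rightarrow>\<^sub>M count_space UNIV"
  unfolding next_record_def by (rule measurable_play)

text \<open>A record contains real prices, but these are fixed by \<open>H\<close>; what remains is
  a list and two Boolean vectors.\<close>

lemma countable_range_next_record: "countable (range (next_record H))"
proof -
  have "range (next_record H) \<subseteq> range (\<lambda>(xs, F, q). plan_record (posted H) xs F q)"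
  proof safe
    fix d
    show "next_record H d \<in> range (\<lambda>(xs, F, q). plan_record (posted H) xs F q)"
      by (rule range_eqI[where x = "(plan (cost M) (tie M H) (fit_mean H) (qual_mean H) (posted H) (fst d), fst (snd d), snd (snd d))"])
        (simp_all add: next_record_def play_eq case_prod_beta)
  qed
  then show ?thesis by (rule countable_subset) (intro countable_image countableI_type)
qed

lemma prices_next_record [simp]: "prices (next_record H d) = posted H"
  by (simp add: next_record_def play_eq)

section \<open>Likelihood of a record and closed form of the posterior\<close>

lemma emeasure_bernoulli_obs:
  "emeasure (bernoulli_PiM \<pi>) {F. \<forall>k. u k \<in> {None, Some (F k)}} = ennreal (\<Prod>k\<in>UNIV. option_lik (u k) (\<pi> k))"
  for u :: "'b \<Rightarrow> bool option"
proof -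
  interpret product_prob_space "\<lambda>j. measure_pmf (bernoulli_pmf (\<pi> j))" UNIV
    by (rule product_prob_space_bernoulli)
  have "{F. \<forall>k. u k \<in> {None, Some (F k)}} = Pi\<^sub>E UNIV (\<lambda>k. {b. u k \<in> {None, Some b}})"
    by (auto simp: PiE_iff)
  then have "emeasure (bernoulli_PiM \<pi>) {F. \<forall>k. u k \<in> {None, Some (F k)}}
     = (\<Prod>k\<in>UNIV. emeasure (measure_pmf (bernoulli_pmf (\<pi> k))) {b. u k \<in> {None, Some b}})"
    by (simp add: emeasure_PiM)
  also have "\<dots> = (\<Prod>k\<in>UNIV. ennreal (option_lik (u k) (\<pi> k)))"
  proof (intro prod.cong refl)
    fix k
    show "emeasure (measure_pmf (bernoulli_pmf (\<pi> k))) {b. u k \<in> {None, Some b}} = ennreal (option_lik (u k) (\<pi> k))"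
    proof (cases "u k")
      case None
      then show ?thesis using measure_pmf.emeasure_space_1 by (simp add: option_lik_def)
    next
      case (Some b)
      then have "{b. u k \<in> {None, Some b}} = {b}" by auto
      then show ?thesis using Some by (simp add: option_lik_def emeasure_pmf_single)
    qed
  qed
  also have "\<dots> = ennreal (\<Prod>k\<in>UNIV. option_lik (u k) (\<pi> k))" by (simp add: prod_ennreal)
  finally show ?thesis .
qed

text \<open>The factor \<open>w\<close> is the probability of a value whose inspection plan is compatible with \<open>r\<close>.
  It does not depend on the parameters, so it cancels in Bayes' rule.\<close>

lemma measure_play_eq:
  "\<exists>w\<ge>0. \<forall>\<theta>. measure (draw_law M \<theta>) {d \<in> space (draw_law M \<theta>). play c ts \<pi>h Qh p d = r}
     = w * ((\<Prod>k\<in>UNIV. option_lik (fits r k) (fst \<theta> k)) * (\<Prod>k\<in>UNIV. option_lik (sale_obs r k) (snd \<theta> k)))"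
proof (intro exI conjI allI)
  define A where "A = {v. \<exists>F q. plan_record p (plan c ts \<pi>h Qh p v) F q = r}"
  show "0 \<le> measure (value_law M) A" by simp
  fix \<theta> :: "'b params"
  interpret F: prob_space "bernoulli_PiM (fst \<theta>)" by (rule prob_space_bernoulli_PiM)
  interpret Q: prob_space "bernoulli_PiM (snd \<theta>)" by (rule prob_space_bernoulli_PiM)
  interpret FQ: prob_space "bernoulli_PiM (fst \<theta>) \<Otimes>\<^sub>M bernoulli_PiM (snd \<theta>)"
    by (intro prob_space_pair F.prob_space_axioms Q.prob_space_axioms)
  interpret D: prob_space "draw_law M \<theta>" by (rule prob_space_draw_law)
  let ?F = "{F. \<forall>k. fits r k \<in> {None, Some (F k)}}" and ?Q = "{q. \<forall>k. sale_obs r k \<in> {None, Some (q k)}}"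
  have A: "A \<in> sets borel"
  proof -
    have "A = plan c ts \<pi>h Qh p -` {xs. \<exists>F q. plan_record p xs F q = r} \<inter> space borel"
      by (auto simp: A_def)
    also have "\<dots> \<in> sets borel" by (rule measurable_sets[OF measurable_plan]) simp
    finally show ?thesis .
  qed
  have sets: "X \<in> sets (bernoulli_PiM \<pi>)" for X and \<pi> :: "'b \<Rightarrow> real"
    using measurable_sets[OF measurable_bernoulli_PiM_count_space, of X] by simp
  have "{d \<in> space (draw_law M \<theta>). play c ts \<pi>h Qh p d = r} = A \<times> (?F \<times> ?Q)"
  proof (rule set_eqI)
    fix d
    show "d \<in> {d \<in> space (draw_law M \<theta>). play c ts \<pi>h Qh p d = r} \<longleftrightarrow> d \<in> A \<times> (?F \<times> ?Q)"
      using plan_record_eq_iff[of p "plan c ts \<pi>h Qh p (fst d)" "fst (snd d)" "snd (snd d)" r]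
      by (simp add: A_def mem_Times_iff play_eq)
  qed
  then have "emeasure (draw_law M \<theta>) {d \<in> space (draw_law M \<theta>). play c ts \<pi>h Qh p d = r}
      = emeasure (value_law M) A * (emeasure (bernoulli_PiM (fst \<theta>)) ?F * emeasure (bernoulli_PiM (snd \<theta>)) ?Q)"
    unfolding draw_law_eq
    by (simp add: FQ.emeasure_pair_measure_Times Q.emeasure_pair_measure_Times A sets)
  then show "measure (draw_law M \<theta>) {d \<in> space (draw_law M \<theta>). play c ts \<pi>h Qh p d = r} = measure (value_law M) A
     * ((\<Prod>k\<in>UNIV. option_lik (fits r k) (fst \<theta> k)) * (\<Prod>k\<in>UNIV. option_lik (sale_obs r k) (snd \<theta> k)))"
    unfolding emeasure_bernoulli_obs D.emeasure_eq_measure V.emeasure_eq_measure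
    by (simp add: prod_nonneg flip: ennreal_mult)
qed

text \<open>Histories outside this set have probability \<open>0\<close>; after them Bayes' rule may divide by \<open>0\<close>
  and the posterior need not be a probability measure.\<close>

primrec possible :: "'b history \<Rightarrow> bool" where
  "possible [] = True"
| "possible (r # H) \<longleftrightarrow> possible H \<and>
     0 < measure truth {d \<in> space truth. play (cost M) (tie M H) (fit_mean H) (qual_mean H) (prices r) d = r}"

abbreviation fit_lik :: "'b history \<Rightarrow> 'b \<Rightarrow> real \<Rightarrow> real" where
  "fit_lik H k \<equiv> history_lik (\<lambda>r. fits r k) H"

abbreviation qual_lik :: "'b history \<Rightarrow> 'b \<Rightarrow> real \<Rightarrow> real" where
  "qual_lik H k \<equiv> history_lik (\<lambda>r. sale_obs r k) H"

text \<open>A record of positive probability under the truth can have no vanishing likelihood factor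
  there. Positivity at the truth suffices for Bayes' rule, because the truth lies in the supports of
  the priors.\<close>

lemma possible_lik_pos:
  assumes "possible H"
  shows "0 < fit_lik H k (fit M k)" "0 < qual_lik H k (qual M k)"
proof -
  from assms have "0 < fit_lik H k (fit M k) \<and> 0 < qual_lik H k (qual M k)"
  proof (induction H)
    case (Cons r H)
    obtain w where w: "measure truth {d \<in> space truth.
          play (cost M) (tie M H) (fit_mean H) (qual_mean H) (prices r) d = r}
        = w * ((\<Prod>k\<in>UNIV. option_lik (fits r k) (fit M k)) * (\<Prod>k\<in>UNIV. option_lik (sale_obs r k) (qual M k)))"
      using measure_play_eq[of "cost M" "tie M H" "fit_mean H" "qual_mean H" "prices r" r] by fastforce
    then have "w * ((\<Prod>k\<in>UNIV. option_lik (fits r k) (fit M k)) * (\<Prod>k\<in>UNIV. option_lik (sale_obs r k) (qual M k))) > 0"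
      using Cons.prems by simp
    then have "(\<Prod>k\<in>UNIV. option_lik (fits r k) (fit M k)) \<noteq> 0"
        "(\<Prod>k\<in>UNIV. option_lik (sale_obs r k) (qual M k)) \<noteq> 0"
      by (metis less_irrefl mult_zero_left mult_zero_right)+
    then have "option_lik (fits r k) (fit M k) \<noteq> 0" "option_lik (sale_obs r k) (qual M k) \<noteq> 0"
      by auto
    then show ?case
      using Cons by (simp add: history_lik_Cons zero_less_mult_iff less_le del: count_obs_simps)
  qed simp
  then show "0 < fit_lik H k (fit M k)" "0 < qual_lik H k (qual M k)" by auto
qed

lemma possible_integral:
  assumes "possible H"
  shows "(\<integral>\<^sup>+x. fit_lik H k x \<partial>priorF M k) \<noteq> 0" "(\<integral>\<^sup>+x. qual_lik H k x \<partial>priorQ M k) \<noteq> 0"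
  by (rule nn_integral_bernoulli_lik_nonzero[OF prior(1) prior_unitF support(1) possible_lik_pos(1)[OF assms]]
        nn_integral_bernoulli_lik_nonzero[OF prior(2) prior_unit(2) support(2) possible_lik_pos(2)[OF assms]])+

lemma lik_integral_finite:
  "(\<integral>\<^sup>+x. fit_lik H k x \<partial>priorF M k) \<noteq> \<infinity>" "(\<integral>\<^sup>+x. qual_lik H k x \<partial>priorQ M k) \<noteq> \<infinity>"
  by (rule nn_integral_bernoulli_lik_finite[OF prior(1) prior_unitF]
        nn_integral_bernoulli_lik_finite[OF prior(2) prior_unit(2)])+

text \<open>The beliefs and prices used by the consumer enter the likelihood of a round only through
  the constant \<open>w\<close>, so the self-reference of the posterior in its own recursion cancels
  and only the observation factors accumulate.\<close>

lemma posterior_eq: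
  assumes "possible H"
  shows "posterior M H = bayes_update (PiM UNIV (priorF M) \<Otimes>\<^sub>M PiM UNIV (priorQ M))
    (\<lambda>\<theta>. (\<Prod>k\<in>UNIV. fit_lik H k (fst \<theta> k)) * (\<Prod>k\<in>UNIV. qual_lik H k (snd \<theta> k)))"
  using assms
proof (induction H)
  case Nil
  have [simp]: "emeasure (PiM UNIV (priorF M) \<Otimes>\<^sub>M PiM UNIV (priorQ M))
     (space (PiM UNIV (priorF M) \<Otimes>\<^sub>M PiM UNIV (priorQ M))) = 1"
    by (intro prob_space.emeasure_space_1 prob_space_pair prob_space_PiM)
      (use prior in \<open>auto simp: real_distribution_def\<close>)
  show ?case by (simp add: bayes_update_def density_1)
next
  case (Cons r H)
  let ?P = "PiM UNIV (priorF M) \<Otimes>\<^sub>M PiM UNIV (priorQ M)"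
  let ?L = "\<lambda>H \<theta>. (\<Prod>k\<in>UNIV. fit_lik H k (fst \<theta> k)) * (\<Prod>k\<in>UNIV. qual_lik H k (snd \<theta> k))"
  let ?l = "\<lambda>\<theta>. (\<Prod>k\<in>UNIV. option_lik (fits r k) (fst \<theta> k)) * (\<Prod>k\<in>UNIV. option_lik (sale_obs r k) (snd \<theta> k))"
  have [measurable_cong]: "sets (priorF M k) = sets borel" "sets (priorQ M k) = sets borel" for k
    using prior by (auto simp: real_distribution_def real_distribution_axioms_def)
  have [measurable]: "option_lik u \<in> borel_measurable borel" for u
    by (cases u; cases "the u") (simp_all add: option_lik_def[abs_def] pmf_bernoulli_pmf)
  have "possible H" using Cons.prems by simp
  obtain w where w: "w \<ge> 0" "\<And>\<theta>. measure (draw_law M \<theta>)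
      {d \<in> space (draw_law M \<theta>). play (cost M) (tie M H) (fit_mean H) (qual_mean H) (prices r) d = r} = w * ?l \<theta>"
    using measure_play_eq by meson
  \<comment> \<open>At the true parameters this probability is positive because the extended history
    is \<open>possible\<close>.\<close>
  have "w \<noteq> 0" using Cons.prems w(2)[of "(fit M, qual M)"] by auto
  then have "w > 0" using w(1) by simp
  have "posterior M (r # H) = bayes_update (posterior M H) (\<lambda>\<theta>. w * ?l \<theta>)"
    unfolding posterior.simps using w(2) by (simp add: beliefF_def beliefQ_def)
  also have "\<dots> = bayes_update (bayes_update ?P (?L H)) (\<lambda>\<theta>. w * ?l \<theta>)"
    using Cons.IH[OF \<open>possible H\<close>] by simp
  also have "\<dots> = bayes_update (bayes_update ?P (?L H)) ?l"
  proof (rule bayes_update_scale[OF _ \<open>w > 0\<close>])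
    have "?l \<in> borel_measurable ?P" by measurable
    then show "?l \<in> borel_measurable (bayes_update ?P (?L H))"
      by (subst measurable_cong_sets[OF sets_bayes_update refl])
  qed
  also have "\<dots> = bayes_update ?P (\<lambda>\<theta>. ?L H \<theta> * ?l \<theta>)"
  proof (rule bayes_update_bayes_update)
    show "?L H \<in> borel_measurable ?P" "?l \<in> borel_measurable ?P" by measurable
    show "AE \<theta> in ?P. 0 \<le> ?L H \<theta>" by (simp add: prod_nonneg)
    show "(\<integral>\<^sup>+\<theta>. ?L H \<theta> \<partial>?P) \<noteq> 0"
      by (rule nn_integral_lik_nonzero[where f = "fit_lik H" and g = "qual_lik H"];
          rule prior possible_integral[OF \<open>possible H\<close>] lik_integral_finite bernoulli_lik_nonneg
            borel_measurable_bernoulli_lik)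
    show "(\<integral>\<^sup>+\<theta>. ?L H \<theta> \<partial>?P) \<noteq> \<infinity>"
      by (rule nn_integral_lik_finite[where f = "fit_lik H" and g = "qual_lik H"];
          rule prior possible_integral[OF \<open>possible H\<close>] lik_integral_finite bernoulli_lik_nonneg
            borel_measurable_bernoulli_lik)
  qed
  also have "(\<lambda>\<theta>. ?L H \<theta> * ?l \<theta>) = ?L (r # H)"
    unfolding history_lik_Cons prod.distrib by (simp add: ac_simps)
  finally show ?case .
qed

text \<open>The other businesses integrate out: a belief about \<open>k\<close> reads the history
  only through the observations of \<open>k\<close>.\<close>

lemma belief_eq:
  assumes "possible H"
  shows "beliefF M H k = bayes_update (priorF M k) (fit_lik H k)"
    and "beliefQ M H k = bayes_update (priorQ M k) (qual_lik H k)"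
  unfolding beliefF_def beliefQ_def posterior_eq[OF assms]
  by (rule fit_marginal_bayes_update[where f = "fit_lik H" and g = "qual_lik H"]
        qual_marginal_bayes_update[where f = "fit_lik H" and g = "qual_lik H"];
      rule prior possible_integral[OF assms] lik_integral_finite bernoulli_lik_nonneg
        borel_measurable_bernoulli_lik)+

lemma real_distribution_belief:
  assumes "possible H"
  shows "real_distribution (beliefF M H k)" "real_distribution (beliefQ M H k)"
  unfolding belief_eq[OF assms]
  by (rule real_distribution_bernoulli_posterior[OF prior(1) prior_unitF possible_integral(1)[OF assms]]
        real_distribution_bernoulli_posterior[OF prior(2) prior_unit(2) possible_integral(2)[OF assms]])+

text \<open>The mean quality is the slope of the index in the value, so these bounds limit how much
  of the index is lost below \<open>Vbar M\<close>.\<close>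

lemma qual_mean_bounds:
  assumes "possible H"
  shows "0 \<le> qual_mean H k" "qual_mean H k \<le> 1"
proof -
  interpret real_distribution "beliefQ M H k" by (rule real_distribution_belief[OF assms])
  have sets: "sets (priorQ M k) = sets borel"
    using prior(2)[of k] by (auto simp: real_distribution_def real_distribution_axioms_def)
  have "qual_lik H k \<in> borel_measurable (priorQ M k)"
    unfolding measurable_cong_sets[OF sets refl] by (rule borel_measurable_bernoulli_lik)
  then have AE: "AE x in beliefQ M H k. 0 \<le> x \<and> x \<le> 1"
    unfolding belief_eq(2)[OF assms] by (rule AE_bayes_update) (rule prior_unit(2))
  then show "0 \<le> qual_mean H k" unfolding mean_def by (intro integral_nonneg_AE) auto
  have "integrable (beliefQ M H k) (\<lambda>x. x)"
    using AE by (intro integrable_const_bound[of _ 1]) auto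
  then have "qual_mean H k \<le> (\<integral>x. 1 \<partial>beliefQ M H k)"
    unfolding mean_def using AE by (intro integral_mono_AE) auto
  then show "qual_mean H k \<le> 1" using prob_space by simp
qed

subsection \<open>Supermartingales along the history\<close>

abbreviation record_at :: "(nat \<Rightarrow> 'b draw) \<Rightarrow> nat \<Rightarrow> 'b round_record" where
  "record_at \<omega> n \<equiv> next_record (hist M s \<omega> n) (\<omega> n)"

sublocale truth: prob_space truth
  by (rule prob_space_draw_law)

lemma emeasure_truth_UNIV [simp]: "emeasure truth UNIV = 1"
  using truth.emeasure_space_1 by simp

sublocale draws: sequence_space truth
  by (simp add: sequence_space_def product_prob_space_def product_sigma_finite_def
      product_prob_space_axioms_def truth.prob_space_axioms truth.sigma_finite_measure_axioms)

lemma length_hist [simp]: "length (hist M s \<omega> n) = n"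
  by (induction n) (auto simp: Let_def)

lemma hist_Suc: "hist M s \<omega> (Suc n) = record_at \<omega> n # hist M s \<omega> n"
  by (simp add: Let_def next_record_def posted_def[abs_def])

declare hist.simps(2) [simp del]

lemma hist_cong: "(\<And>i. i < n \<Longrightarrow> \<omega> i = \<omega>' i) \<Longrightarrow> hist M s \<omega> n = hist M s \<omega>' n"
  by (induction n) (auto simp: hist_Suc)

lemma countable_range_hist: "countable (range (\<lambda>\<omega>. hist M s \<omega> n))"
proof (induction n)
  case (Suc n)
  have "range (\<lambda>\<omega>. hist M s \<omega> (Suc n))
      \<subseteq> (\<Union>H\<in>range (\<lambda>\<omega>. hist M s \<omega> n). (\<lambda>r. r # H) ` range (next_record H))"
    by (auto simp: hist_Suc)
  then show ?case
    by (rule countable_subset)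
      (intro countable_UN countable_image Suc.IH countable_range_next_record)
qed simp

text \<open>The target is the discrete space on the reachable histories. They are countably many,
  unlike arbitrary histories with their real prices, and composing case by case needs a countable
  range.\<close>

lemma measurable_hist: "(\<lambda>\<omega>. hist M s \<omega> n) \<in> draws.S \<rightarrow>\<^sub>M count_space (range (\<lambda>\<omega>. hist M s \<omega> n))"
proof (induction n)
  case 0
  have "range (\<lambda>\<omega>. hist M s \<omega> 0) = {[]}" by auto
  then show ?case by simp
next
  case (Suc n)
  have "(\<lambda>\<omega>. next_record (hist M s \<omega> n) (\<omega> n) # hist M s \<omega> n) \<in> draws.S \<rightarrow>\<^sub>M count_space UNIV"
  proof (rule measurable_compose_countable'[OF _ Suc.IH countable_range_hist])
    fix H
    have "(\<lambda>\<omega>. next_record H (\<omega> n)) \<in> draws.S \<rightarrow>\<^sub>M count_space UNIV"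
      by (rule measurable_compose[OF _ measurable_next_record[where \<theta> = "(fit M, qual M)"]]) simp
    from measurable_compose[OF this, of "\<lambda>r. r # H" "count_space UNIV"]
    show "(\<lambda>\<omega>. next_record H (\<omega> n) # H) \<in> draws.S \<rightarrow>\<^sub>M count_space UNIV" by simp
  qed
  then have meas: "(\<lambda>\<omega>. hist M s \<omega> (Suc n)) \<in> draws.S \<rightarrow>\<^sub>M count_space UNIV"
    by (simp add: hist_Suc)
  show ?case
    by (subst measurable_count_space_eq_countable[OF countable_range_hist])
      (use measurable_sets[OF meas] in auto)
qed

lemma measurable_hist_draw:
  assumes "\<And>H. f H \<in> truth \<rightarrow>\<^sub>M N"
  shows "(\<lambda>\<omega>. f (hist M s \<omega> n) (\<omega> n)) \<in> draws.S \<rightarrow>\<^sub>M N"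
proof (rule measurable_compose_countable'[OF _ measurable_hist countable_range_hist])
  fix H
  show "(\<lambda>\<omega>. f H (\<omega> n)) \<in> draws.S \<rightarrow>\<^sub>M N"
    by (rule measurable_compose[OF _ assms]) simp
qed

text \<open>Takes the place of conditional expectation given the first \<open>n\<close> rounds.
  Splicing the first \<open>n\<close> draws of one sequence with an independent sequence preserves
  the law; the history sees only the former, and draw \<open>n\<close> becomes entry 0 of the
  latter.\<close>

lemma nn_integral_hist_draw:
  assumes [measurable]: "\<And>H. f H \<in> borel_measurable truth"
  shows "(\<integral>\<^sup>+\<omega>. f (hist M s \<omega> n) (\<omega> n) \<partial>draws.S) = (\<integral>\<^sup>+\<omega>. \<integral>\<^sup>+d. f (hist M s \<omega> n) d \<partial>truth \<partial>draws.S)"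
proof -
  let ?g = "\<lambda>\<omega>. f (hist M s \<omega> n) (\<omega> n)"
  have g: "?g \<in> borel_measurable draws.S" by (rule measurable_hist_draw) simp
  have comb: "(\<lambda>(\<omega>, \<omega>'). comb_seq n \<omega> \<omega>') \<in> draws.S \<Otimes>\<^sub>M draws.S \<rightarrow>\<^sub>M draws.S"
    by (rule measurable_comb_seq)
  have eq: "?g (comb_seq n \<omega> \<omega>') = f (hist M s \<omega> n) (\<omega>' 0)" for \<omega> \<omega>'
  proof -
    have "hist M s (comb_seq n \<omega> \<omega>') n = hist M s \<omega> n" by (rule hist_cong) (simp add: comb_seq_less)
    moreover have "comb_seq n \<omega> \<omega>' n = \<omega>' 0" by (simp add: comb_seq_def)
    ultimately show ?thesis by simp
  qed
  have "(\<integral>\<^sup>+\<omega>. ?g \<omega> \<partial>draws.S) = (\<integral>\<^sup>+\<omega>. ?g \<omega> \<partial>distr (draws.S \<Otimes>\<^sub>M draws.S) draws.S (\<lambda>(\<omega>, \<omega>'). comb_seq n \<omega> \<omega>'))"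
    by (simp add: draws.PiM_comb_seq)
  also have "\<dots> = (\<integral>\<^sup>+x. ?g (case x of (\<omega>, \<omega>') \<Rightarrow> comb_seq n \<omega> \<omega>') \<partial>(draws.S \<Otimes>\<^sub>M draws.S))"
    using g by (intro nn_integral_distr[OF comb]) simp
  also have "\<dots> = (\<integral>\<^sup>+\<omega>. \<integral>\<^sup>+\<omega>'. ?g (comb_seq n \<omega> \<omega>') \<partial>draws.S \<partial>draws.S)"
    using measurable_compose[OF comb g]
    by (subst draws.nn_integral_fst[symmetric]) simp_all
  also have "\<dots> = (\<integral>\<^sup>+\<omega>. \<integral>\<^sup>+\<omega>'. f (hist M s \<omega> n) (\<omega>' 0) \<partial>draws.S \<partial>draws.S)"
    by (simp only: eq)
  also have "\<dots> = (\<integral>\<^sup>+\<omega>. \<integral>\<^sup>+d. f (hist M s \<omega> n) d \<partial>truth \<partial>draws.S)"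
  proof (rule nn_integral_cong)
    fix \<omega>
    have "(\<integral>\<^sup>+d. f (hist M s \<omega> n) d \<partial>truth) = (\<integral>\<^sup>+d. f (hist M s \<omega> n) d \<partial>distr draws.S truth (\<lambda>\<omega>. \<omega> 0))"
      by (subst draws.PiM_component) simp_all
    also have "\<dots> = (\<integral>\<^sup>+\<omega>'. f (hist M s \<omega> n) (\<omega>' 0) \<partial>draws.S)"
      by (rule nn_integral_distr) simp_all
    finally show "(\<integral>\<^sup>+\<omega>'. f (hist M s \<omega> n) (\<omega>' 0) \<partial>draws.S) = (\<integral>\<^sup>+d. f (hist M s \<omega> n) d \<partial>truth)" ..
  qed
  finally show ?thesis .
qed

lemma AE_hist_draw:
  assumes AE: "\<And>H. AE d in truth. P H d" and meas: "\<And>H. Measurable.pred truth (P H)"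
  shows "AE \<omega> in draws.S. \<forall>n. P (hist M s \<omega> n) (\<omega> n)"
proof (subst AE_all_countable, intro allI)
  fix n
  have [measurable]: "indicator {d. \<not> P H d} \<in> borel_measurable truth" for H
    using sets.sets_Collect_neg[of truth "P H"] meas[of H]
    by (intro borel_measurable_indicator) (simp add: pred_def)
  have "(\<integral>\<^sup>+\<omega>. indicator {d. \<not> P (hist M s \<omega> n) d} (\<omega> n) \<partial>draws.S)
      = (\<integral>\<^sup>+\<omega>. \<integral>\<^sup>+d. indicator {d. \<not> P (hist M s \<omega> n) d} d \<partial>truth \<partial>draws.S)"
    by (rule nn_integral_hist_draw) simp
  also have "\<dots> = (\<integral>\<^sup>+\<omega>. 0 \<partial>draws.S)"
  proof (rule nn_integral_cong)
    fix \<omega>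
    show "(\<integral>\<^sup>+d. indicator {d. \<not> P (hist M s \<omega> n) d} d \<partial>truth) = (0::ennreal)"
      using AE[of "hist M s \<omega> n"] meas[of "hist M s \<omega> n"]
      by (subst (asm) AE_iff_nn_integral) (auto simp: pred_def)
  qed
  finally have "(\<integral>\<^sup>+\<omega>. indicator {\<omega>. \<not> P (hist M s \<omega> n) (\<omega> n)} \<omega> \<partial>draws.S) = 0"
    by (simp add: indicator_def)
  moreover have "Measurable.pred draws.S (\<lambda>\<omega>. P (hist M s \<omega> n) (\<omega> n))"
    using meas by (rule measurable_hist_draw)
  ultimately show "AE \<omega> in draws.S. P (hist M s \<omega> n) (\<omega> n)"
    by (subst AE_iff_nn_integral) (simp_all add: pred_def)
qed

text \<open>Given the history, the next record takes countably many values, so almost surely the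
  realised one has positive probability.\<close>

lemma AE_possible: "AE \<omega> in draws.S. \<forall>n. possible (hist M s \<omega> n)"
proof -
  have "AE \<omega> in draws.S. \<forall>n. 0 < measure truth {e \<in> space truth. next_record (hist M s \<omega> n) e = record_at \<omega> n}"
  proof (rule AE_hist_draw)
    fix H
    show "AE d in truth. 0 < measure truth {e \<in> space truth. next_record H e = next_record H d}"
      using AE_singleton_pos[OF measurable_next_record[where \<theta> = "(fit M, qual M)" and H = H] countable_range_next_record]
      by (simp add: truth.emeasure_eq_measure)
    show "Measurable.pred truth (\<lambda>d. 0 < measure truth {e \<in> space truth. next_record H e = next_record H d})"
      using measurable_compose[OF measurable_next_record,
          of "\<lambda>r. 0 < measure truth {e \<in> space truth. next_record H e = r}" "count_space UNIV"] by simp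
  qed
  then show ?thesis
  proof eventually_elim
    case (elim \<omega>)
    show ?case
    proof
      fix n show "possible (hist M s \<omega> n)"
      proof (induction n)
        case (Suc n)
        have "0 < measure truth {e \<in> space truth. next_record (hist M s \<omega> n) e = record_at \<omega> n}"
          using elim by blast
        then show ?case using Suc by (simp add: hist_Suc) (simp add: next_record_def)
      qed simp
    qed
  qed
qed

text \<open>In expectation the weight drops in each round by at least \<open>\<kappa>\<close> times
  its current value on the event \<open>T\<close>. Telescoping bounds the expected sum of the
  weights over the rounds with \<open>T\<close> by \<open>1 / \<kappa>\<close>. The event may depend
  on the record of the round itself, while the weight summed is the one before the round.\<close>

lemma supermartingale_sum_finite:
  fixes w :: "'b history \<Rightarrow> 'b round_record \<Rightarrow> ennreal" and T :: "'b history \<Rightarrow> 'b round_record \<Rightarrow> bool"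
  assumes \<kappa>: "0 < \<kappa>"
    and drift: "\<And>H. (\<integral>\<^sup>+d. w H (next_record H d) + ennreal \<kappa> * of_bool (T H (next_record H d)) \<partial>truth) \<le> 1"
  shows "AE \<omega> in draws.S.
    (\<Sum>n. if T (hist M s \<omega> n) (record_at \<omega> n) then weight_prod w (hist M s \<omega> n) else 0) \<noteq> \<top>"
proof -
  let ?Z = "\<lambda>n \<omega>. weight_prod w (hist M s \<omega> n)"
  let ?t = "\<lambda>n \<omega>. if T (hist M s \<omega> n) (record_at \<omega> n) then weight_prod w (hist M s \<omega> n) else 0"
  have rec: "(\<lambda>d. g H (next_record H d)) \<in> borel_measurable truth"
    for g :: "'b history \<Rightarrow> 'b round_record \<Rightarrow> ennreal" and H
    by (rule measurable_compose[OF measurable_next_record]) simp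
  have meas: "(\<lambda>\<omega>. g (hist M s \<omega> n) (record_at \<omega> n)) \<in> borel_measurable draws.S"
    for g :: "'b history \<Rightarrow> 'b round_record \<Rightarrow> ennreal" and n
    by (rule measurable_hist_draw[where f = "\<lambda>H d. g H (next_record H d)"]) (rule rec)
  have t: "?t n \<in> borel_measurable draws.S" for n
    using meas[of "\<lambda>H r. if T H r then weight_prod w H else 0" n] by simp
  have Z: "?Z n \<in> borel_measurable draws.S" for n
    using meas[of "\<lambda>H r. weight_prod w H" n] by simp
  have step: "(\<integral>\<^sup>+\<omega>. ?Z (Suc n) \<omega> \<partial>draws.S) + ennreal \<kappa> * (\<integral>\<^sup>+\<omega>. ?t n \<omega> \<partial>draws.S) \<le> (\<integral>\<^sup>+\<omega>. ?Z n \<omega> \<partial>draws.S)" for n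
  proof -
    let ?f = "\<lambda>H d. (w H (next_record H d) + ennreal \<kappa> * of_bool (T H (next_record H d))) * weight_prod w H"
    have "(\<integral>\<^sup>+\<omega>. ?Z (Suc n) \<omega> \<partial>draws.S) + ennreal \<kappa> * (\<integral>\<^sup>+\<omega>. ?t n \<omega> \<partial>draws.S)
        = (\<integral>\<^sup>+\<omega>. ?Z (Suc n) \<omega> + ennreal \<kappa> * ?t n \<omega> \<partial>draws.S)"
      using t Z by (simp add: nn_integral_add nn_integral_cmult)
    also have "\<dots> = (\<integral>\<^sup>+\<omega>. ?f (hist M s \<omega> n) (\<omega> n) \<partial>draws.S)"
      by (intro nn_integral_cong) (auto simp: hist_Suc algebra_simps)
    also have "\<dots> = (\<integral>\<^sup>+\<omega>. \<integral>\<^sup>+d. ?f (hist M s \<omega> n) d \<partial>truth \<partial>draws.S)"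
      by (rule nn_integral_hist_draw)
        (rule rec[of "\<lambda>H r. (w H r + ennreal \<kappa> * of_bool (T H r)) * weight_prod w H"])
    also have "\<dots> \<le> (\<integral>\<^sup>+\<omega>. ?Z n \<omega> \<partial>draws.S)"
    proof (rule nn_integral_mono)
      fix \<omega>
      let ?H = "hist M s \<omega> n"
      have "(\<integral>\<^sup>+d. ?f ?H d \<partial>truth)
          = (\<integral>\<^sup>+d. w ?H (next_record ?H d) + ennreal \<kappa> * of_bool (T ?H (next_record ?H d)) \<partial>truth) * weight_prod w ?H"
        by (rule nn_integral_multc)
          (rule rec[of "\<lambda>H r. w H r + ennreal \<kappa> * of_bool (T H r)"])
      also have "\<dots> \<le> 1 * weight_prod w ?H" by (intro mult_right_mono drift) simp
      finally show "(\<integral>\<^sup>+d. ?f ?H d \<partial>truth) \<le> ?Z n \<omega>" by simp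
    qed
    finally show ?thesis .
  qed
  \<comment> \<open>The first summand carries the induction: each step trades part of it for the
    next expected term.\<close>
  have partial: "(\<integral>\<^sup>+\<omega>. ?Z n \<omega> \<partial>draws.S) + ennreal \<kappa> * (\<Sum>i<n. \<integral>\<^sup>+\<omega>. ?t i \<omega> \<partial>draws.S) \<le> 1" for n
  proof (induction n)
    case 0
    show ?case by (simp add: draws.emeasure_space_1)
  next
    case (Suc n)
    have "(\<integral>\<^sup>+\<omega>. ?Z (Suc n) \<omega> \<partial>draws.S) + ennreal \<kappa> * (\<Sum>i<Suc n. \<integral>\<^sup>+\<omega>. ?t i \<omega> \<partial>draws.S)
       = ((\<integral>\<^sup>+\<omega>. ?Z (Suc n) \<omega> \<partial>draws.S) + ennreal \<kappa> * (\<integral>\<^sup>+\<omega>. ?t n \<omega> \<partial>draws.S))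
          + ennreal \<kappa> * (\<Sum>i<n. \<integral>\<^sup>+\<omega>. ?t i \<omega> \<partial>draws.S)"
      by (simp only: sum.lessThan_Suc distrib_left ac_simps)
    also have "\<dots> \<le> (\<integral>\<^sup>+\<omega>. ?Z n \<omega> \<partial>draws.S) + ennreal \<kappa> * (\<Sum>i<n. \<integral>\<^sup>+\<omega>. ?t i \<omega> \<partial>draws.S)"
      by (intro add_right_mono step)
    also have "\<dots> \<le> 1" by (rule Suc.IH)
    finally show ?case .
  qed
  have "ennreal \<kappa> * (\<Sum>i<n. \<integral>\<^sup>+\<omega>. ?t i \<omega> \<partial>draws.S) \<le> 1" for n
    using partial[of n] by (rule order_trans[rotated]) simp
  then have "(\<Sum>i<n. ennreal \<kappa> * (\<integral>\<^sup>+\<omega>. ?t i \<omega> \<partial>draws.S)) \<le> 1" for n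
    by (simp add: sum_distrib_left)
  then have "(\<Sum>i. ennreal \<kappa> * (\<integral>\<^sup>+\<omega>. ?t i \<omega> \<partial>draws.S)) \<le> 1"
    by (intro suminf_le_const) auto
  then have "ennreal \<kappa> * (\<integral>\<^sup>+\<omega>. (\<Sum>i. ?t i \<omega>) \<partial>draws.S) \<le> 1"
    using t by (simp add: nn_integral_suminf)
  then have "(\<integral>\<^sup>+\<omega>. (\<Sum>i. ?t i \<omega>) \<partial>draws.S) \<noteq> \<infinity>"
    using \<kappa> by (auto simp: ennreal_mult_top top_unique)
  then have "AE \<omega> in draws.S. (\<Sum>i. ?t i \<omega>) \<noteq> \<infinity>"
    using t by (intro nn_integral_PInf_AE) auto
  then show ?thesis by simp
qed

text \<open>The weight halves at each success, so with finitely many successes it stays bounded below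
  along the infinitely many rounds in which \<open>G\<close> holds.\<close>

lemma conditional_Borel_Cantelli:
  fixes G :: "'b history \<Rightarrow> bool" and I :: "'b round_record \<Rightarrow> bool"
  assumes \<delta>: "0 < \<delta>" and lower: "\<And>H. G H \<Longrightarrow> ennreal \<delta> \<le> emeasure truth {d \<in> space truth. I (next_record H d)}"
  shows "AE \<omega> in draws.S. infinite {n. G (hist M s \<omega> n)} \<longrightarrow> infinite {n. I (record_at \<omega> n)}"
proof -
  define w :: "'b history \<Rightarrow> 'b round_record \<Rightarrow> ennreal" where
    "w H r = ennreal (if G H \<and> I r then 1 / 2 else 1)" for H r
  \<comment> \<open>A round with \<open>G H\<close> succeeds with probability at least
    \<open>\<delta>\<close> and then gives up half of the weight, which pays for the constant
    \<open>\<delta> / 2\<close>.\<close>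
  have drift: "(\<integral>\<^sup>+d. w H (next_record H d) + ennreal (\<delta> / 2) * of_bool (G H) \<partial>truth) \<le> 1" for H
  proof (cases "G H")
    case False
    then show ?thesis by (simp add: w_def truth.emeasure_space_1)
  next
    case True
    let ?A = "{d \<in> space truth. I (next_record H d)}"
    have A: "?A \<in> sets truth"
      using measurable_sets[OF measurable_next_record[where \<theta> = "(fit M, qual M)" and H = H], of "{r. I r}"] by (simp add: vimage_def)
    have [measurable]: "(\<lambda>d. w H (next_record H d)) \<in> borel_measurable truth"
      by (rule measurable_compose[OF measurable_next_record]) simp
    have "(\<integral>\<^sup>+d. w H (next_record H d) + ennreal (\<delta> / 2) * of_bool (G H) \<partial>truth)
        = (\<integral>\<^sup>+d. w H (next_record H d) \<partial>truth) + ennreal (1 / 2) * ennreal \<delta>"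
      using True \<delta> by (simp add: nn_integral_add del: ennreal_half flip: ennreal_mult)
    also have "\<dots> \<le> (\<integral>\<^sup>+d. w H (next_record H d) \<partial>truth) + ennreal (1 / 2) * emeasure truth ?A"
      by (intro add_left_mono mult_left_mono lower True) simp
    also have "\<dots> = (\<integral>\<^sup>+d. w H (next_record H d) \<partial>truth) + (\<integral>\<^sup>+d. ennreal (1 / 2) * indicator ?A d \<partial>truth)"
      using A by (simp only: nn_integral_cmult_indicator)
    also have "\<dots> = (\<integral>\<^sup>+d. w H (next_record H d) + ennreal (1 / 2) * indicator ?A d \<partial>truth)"
      using A by (intro nn_integral_add[symmetric]) auto
    also have "\<dots> = (\<integral>\<^sup>+d. 1 \<partial>truth)"
      using True by (intro nn_integral_cong)
        (auto simp: w_def indicator_def simp del: ennreal_half ennreal_plus simp flip: ennreal_plus)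
    finally show ?thesis by (simp add: truth.emeasure_space_1)
  qed
  have fin: "AE \<omega> in draws.S. (\<Sum>n. if G (hist M s \<omega> n) then weight_prod w (hist M s \<omega> n) else 0) \<noteq> \<top>"
    using supermartingale_sum_finite[of "\<delta> / 2" w "\<lambda>H r. G H"] \<delta> drift by simp
  have wp: "ennreal ((1 / 2) ^ card {i. i < n \<and> I (record_at \<omega> i)}) \<le> weight_prod w (hist M s \<omega> n)" for \<omega> n
  proof (induction n)
    case (Suc n)
    have "{i. i < Suc n \<and> I (record_at \<omega> i)}
        = (if I (record_at \<omega> n) then insert n {i. i < n \<and> I (record_at \<omega> i)} else {i. i < n \<and> I (record_at \<omega> i)})"
      by (auto simp: less_Suc_eq)
    then have "(1 / 2) ^ card {i. i < Suc n \<and> I (record_at \<omega> i)}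
        = (if I (record_at \<omega> n) then 1 / 2 else 1) * (1 / 2 :: real) ^ card {i. i < n \<and> I (record_at \<omega> i)}"
      by auto
    then have "ennreal ((1 / 2) ^ card {i. i < Suc n \<and> I (record_at \<omega> i)})
        = ennreal (if I (record_at \<omega> n) then 1 / 2 else 1) * ennreal ((1 / 2) ^ card {i. i < n \<and> I (record_at \<omega> i)})"
      by (simp only: ennreal_mult'[symmetric] zero_le_power zero_le_divide_1_iff zero_le_numeral ennreal_mult'')
    also have "\<dots> \<le> w (hist M s \<omega> n) (record_at \<omega> n) * weight_prod w (hist M s \<omega> n)"
      by (intro mult_mono Suc.IH) (auto simp: w_def simp del: ennreal_half intro!: ennreal_leI)
    finally show ?case by (simp add: hist_Suc)
  qed simp
  show ?thesis
    using fin
  proof eventually_elim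
    case (elim \<omega>)
    show ?case
    proof (intro impI notI)
      assume inf: "infinite {n. G (hist M s \<omega> n)}" and I: "finite {n. I (record_at \<omega> n)}"
      define c :: real where "c = (1 / 2) ^ card {n. I (record_at \<omega> n)}"
      have "ennreal c \<le> weight_prod w (hist M s \<omega> n)" for n
      proof -
        have "card {i. i < n \<and> I (record_at \<omega> i)} \<le> card {n. I (record_at \<omega> n)}"
          by (intro card_mono I) auto
        then have "c \<le> (1 / 2) ^ card {i. i < n \<and> I (record_at \<omega> i)}"
          unfolding c_def by (intro power_decreasing) auto
        then show ?thesis by (intro order_trans[OF ennreal_leI wp])
      qed
      then have "{n. G (hist M s \<omega> n)}
          \<subseteq> {n. ennreal c \<le> (if G (hist M s \<omega> n) then weight_prod w (hist M s \<omega> n) else 0)}"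
        by auto
      then have "infinite {n. ennreal c \<le> (if G (hist M s \<omega> n) then weight_prod w (hist M s \<omega> n) else 0)}"
        using inf infinite_super by blast
      from suminf_ennreal_eq_top[OF this] elim show False by (simp add: c_def)
    qed
  qed
qed

subsection \<open>Observations as Bernoulli trials\<close>

lemma Vbar_mass:
  assumes "0 < \<epsilon>"
  shows "0 < emeasure (value_law M) {Vbar M - \<epsilon><..}"
proof -
  \<comment> \<open>The supremum of an empty support would be meaningless. An empty support would
    mean that null open sets cover the line, and then countably many of them do.\<close>
  have "msupport (value_law M) \<noteq> {}"
  proof
    assume empty: "msupport (value_law M) = {}"
    define N where "N = {U. open U \<and> emeasure (value_law M) U = 0}"
    have "\<Union>N = UNIV"
      using empty by (auto simp: msupport_def N_def not_less)
    moreover obtain N' where N': "N' \<subseteq> N" "countable N'" "\<Union>N' = \<Union>N"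
      using Lindelof[of N] by (auto simp: N_def)
    moreover have "(\<Union>U\<in>N'. U) \<in> null_sets (value_law M)"
      using N' by (intro null_sets_UN') (auto simp: N_def null_sets_def)
    ultimately show False using V.emeasure_space_1 by (auto simp: null_sets_def)
  qed
  moreover have "bdd_above (msupport (value_law M))"
    using valid by (simp add: valid_market_def bounded_imp_bdd_above)
  ultimately obtain x where x: "x \<in> msupport (value_law M)" "Vbar M - \<epsilon> < x"
    using less_cSup_iff[of "msupport (value_law M)" "Vbar M - \<epsilon>"] assms by (auto simp: Vbar_def)
  then show ?thesis by (auto simp: msupport_def)
qed

lemma nn_integral_truth:
  fixes g :: "'b list \<Rightarrow> ('b \<Rightarrow> bool) \<Rightarrow> ('b \<Rightarrow> bool) \<Rightarrow> ennreal"
  shows "(\<integral>\<^sup>+d. g (plan c ts \<pi>h Qh p (fst d)) (fst (snd d)) (snd (snd d)) \<partial>truth)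
    = (\<integral>\<^sup>+v. \<integral>\<^sup>+F. \<integral>\<^sup>+q. g (plan c ts \<pi>h Qh p v) F q \<partial>bernoulli_PiM (qual M)
        \<partial>bernoulli_PiM (fit M) \<partial>value_law M)"
proof -
  interpret F: prob_space "bernoulli_PiM (fit M)" by (rule prob_space_bernoulli_PiM)
  interpret Q: prob_space "bernoulli_PiM (qual M)" by (rule prob_space_bernoulli_PiM)
  interpret FQ: prob_space "bernoulli_PiM (fit M) \<Otimes>\<^sub>M bernoulli_PiM (qual M)"
    by (intro prob_space_pair F.prob_space_axioms Q.prob_space_axioms)
  have "(\<lambda>d. g (plan c ts \<pi>h Qh p (fst d)) (fst (snd d)) (snd (snd d))) \<in> borel_measurable truth"
    by (rule measurable_count_space_imp_borel[OF measurable_draw])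
  then have "(\<integral>\<^sup>+d. g (plan c ts \<pi>h Qh p (fst d)) (fst (snd d)) (snd (snd d)) \<partial>truth)
    = (\<integral>\<^sup>+v. \<integral>\<^sup>+x. g (plan c ts \<pi>h Qh p v) (fst x) (snd x)
        \<partial>(bernoulli_PiM (fit M) \<Otimes>\<^sub>M bernoulli_PiM (qual M)) \<partial>value_law M)"
    unfolding draw_law_eq fst_conv snd_conv by (subst FQ.nn_integral_fst[symmetric]) simp_all
  also have "\<dots> = (\<integral>\<^sup>+v. \<integral>\<^sup>+F. \<integral>\<^sup>+q. g (plan c ts \<pi>h Qh p v) F q \<partial>bernoulli_PiM (qual M)
        \<partial>bernoulli_PiM (fit M) \<partial>value_law M)"
    by (intro nn_integral_cong, subst Q.nn_integral_fst[symmetric])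
      (simp_all add: measurable_count_space_imp_borel[OF measurable_bernoulli_pair])
  finally show ?thesis .
qed

lemma nn_integral_truth_resample_fit:
  fixes g :: "'b list \<Rightarrow> ('b \<Rightarrow> bool) \<Rightarrow> ('b \<Rightarrow> bool) \<Rightarrow> ennreal"
  shows "(\<integral>\<^sup>+d. g (plan c ts \<pi>h Qh p (fst d)) (fst (snd d)) (snd (snd d)) \<partial>truth)
    = (\<integral>\<^sup>+d. ennreal (fit M j) * g (plan c ts \<pi>h Qh p (fst d)) ((fst (snd d))(j := True)) (snd (snd d))
       + ennreal (1 - fit M j) * g (plan c ts \<pi>h Qh p (fst d)) ((fst (snd d))(j := False)) (snd (snd d)) \<partial>truth)"
    (is "_ = integral\<^sup>N _ (\<lambda>d. ?r (plan c ts \<pi>h Qh p (fst d)) (fst (snd d)) (snd (snd d)))")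
proof -
  have m: "h \<in> borel_measurable (bernoulli_PiM \<pi>)" for h :: "('b \<Rightarrow> bool) \<Rightarrow> ennreal" and \<pi> :: "'b \<Rightarrow> real"
    by (rule measurable_count_space_imp_borel[OF measurable_bernoulli_PiM])
  have "(\<integral>\<^sup>+F. \<integral>\<^sup>+q. g xs F q \<partial>bernoulli_PiM (qual M) \<partial>bernoulli_PiM (fit M))
      = (\<integral>\<^sup>+F. \<integral>\<^sup>+q. ennreal (fit M j) * g xs (F(j := True)) q + ennreal (1 - fit M j) * g xs (F(j := False)) q
           \<partial>bernoulli_PiM (qual M) \<partial>bernoulli_PiM (fit M))" for xs
    using fit_bounds[of j]
    by (subst nn_integral_bernoulli_PiM_resample[of "fit M" j]) (simp_all add: nn_integral_add nn_integral_cmult m)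
  then show ?thesis
    unfolding nn_integral_truth nn_integral_truth[of ?r] by simp
qed

lemma nn_integral_truth_resample_qual:
  fixes g :: "'b list \<Rightarrow> ('b \<Rightarrow> bool) \<Rightarrow> ('b \<Rightarrow> bool) \<Rightarrow> ennreal"
  shows "(\<integral>\<^sup>+d. g (plan c ts \<pi>h Qh p (fst d)) (fst (snd d)) (snd (snd d)) \<partial>truth)
    = (\<integral>\<^sup>+d. ennreal (qual M j) * g (plan c ts \<pi>h Qh p (fst d)) (fst (snd d)) ((snd (snd d))(j := True))
       + ennreal (1 - qual M j) * g (plan c ts \<pi>h Qh p (fst d)) (fst (snd d)) ((snd (snd d))(j := False)) \<partial>truth)"
    (is "_ = integral\<^sup>N _ (\<lambda>d. ?r (plan c ts \<pi>h Qh p (fst d)) (fst (snd d)) (snd (snd d)))")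
proof -
  have "(\<integral>\<^sup>+q. g xs F q \<partial>bernoulli_PiM (qual M))
      = (\<integral>\<^sup>+q. ennreal (qual M j) * g xs F (q(j := True)) + ennreal (1 - qual M j) * g xs F (q(j := False))
           \<partial>bernoulli_PiM (qual M))" for xs F
    using qual_bounds[of j] by (intro nn_integral_bernoulli_PiM_resample)
  then show ?thesis
    unfolding nn_integral_truth nn_integral_truth[of ?r] by simp
qed

text \<open>Tested against arbitrary payoffs: conditionally on the history and on being made at all, the
  observation \<open>f\<close> of the next record is Bernoulli with parameter \<open>p\<close>.\<close>

definition bernoulli_trials :: "('b round_record \<Rightarrow> bool option) \<Rightarrow> real \<Rightarrow> bool" where
  "bernoulli_trials f p \<longleftrightarrow> 0 \<le> p \<and> p \<le> 1 \<and> (\<forall>H a b (c::ennreal).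
     (\<integral>\<^sup>+d. (case f (next_record H d) of None \<Rightarrow> c | Some x \<Rightarrow> if x then a else b) \<partial>truth)
     = (\<integral>\<^sup>+d. (if f (next_record H d) = None then c else ennreal p * a + ennreal (1 - p) * b) \<partial>truth))"

text \<open>Redrawing the fit of \<open>j\<close> does not change whether \<open>j\<close> is
  inspected, so given an inspection the observed fit is a fresh Bernoulli variable.\<close>

lemma bernoulli_trials_fit: "bernoulli_trials (\<lambda>r. fits r j) (fit M j)"
  unfolding bernoulli_trials_def
proof (intro conjI allI)
  fix H and a b c :: ennreal
  define G where "G xs F q = (case fits (plan_record (posted H) xs F q) j of None \<Rightarrow> c | Some x \<Rightarrow> if x then a else b)"
    for xs F q
  have nr: "next_record H d = plan_record (posted H)
      (plan (cost M) (tie M H) (fit_mean H) (qual_mean H) (posted H) (fst d)) (fst (snd d)) (snd (snd d))" for d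
    by (simp add: next_record_def play_eq)
  have "ennreal (fit M j) * G xs (F(j := True)) q + ennreal (1 - fit M j) * G xs (F(j := False)) q
      = (if fits (plan_record (posted H) xs F q) j = None then c
         else ennreal (fit M j) * a + ennreal (1 - fit M j) * b)" for xs F q
    using fit_bounds[of j] ennreal_convex_same[of "fit M j" c]
    by (auto simp: G_def fits_plan_record mem_inspections_upd)
  then show "(\<integral>\<^sup>+d. (case fits (next_record H d) j of None \<Rightarrow> c | Some x \<Rightarrow> if x then a else b) \<partial>truth)
     = (\<integral>\<^sup>+d. (if fits (next_record H d) j = None then c else ennreal (fit M j) * a + ennreal (1 - fit M j) * b) \<partial>truth)"
    unfolding nr G_def[symmetric] by (subst nn_integral_truth_resample_fit[where g = G and j = j]) simp
qed (use fit_bounds[of j] in auto)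

text \<open>Whether \<open>j\<close> is sold depends on the plan and the fits alone, so its quality
  realisation can be redrawn independently of the sale.\<close>

lemma bernoulli_trials_qual: "bernoulli_trials (\<lambda>r. sale_obs r j) (qual M j)"
  unfolding bernoulli_trials_def
proof (intro conjI allI)
  fix H and a b c :: ennreal
  define G where "G xs F q = (case sale_obs (plan_record (posted H) xs F q) j of None \<Rightarrow> c | Some x \<Rightarrow> if x then a else b)"
    for xs F q
  have nr: "next_record H d = plan_record (posted H)
      (plan (cost M) (tie M H) (fit_mean H) (qual_mean H) (posted H) (fst d)) (fst (snd d)) (snd (snd d))" for d
    by (simp add: next_record_def play_eq)
  have "ennreal (qual M j) * G xs F (q(j := True)) + ennreal (1 - qual M j) * G xs F (q(j := False))
      = (if sale_obs (plan_record (posted H) xs F q) j = None then c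
         else ennreal (qual M j) * a + ennreal (1 - qual M j) * b)" for xs F q
    using qual_bounds[of j] ennreal_convex_same[of "qual M j" c]
    by (auto simp: G_def sale_obs_plan_record)
  then show "(\<integral>\<^sup>+d. (case sale_obs (next_record H d) j of None \<Rightarrow> c | Some x \<Rightarrow> if x then a else b) \<partial>truth)
     = (\<integral>\<^sup>+d. (if sale_obs (next_record H d) j = None then c else ennreal (qual M j) * a + ennreal (1 - qual M j) * b) \<partial>truth)"
    unfolding nr G_def[symmetric] by (subst nn_integral_truth_resample_qual[where g = G and j = j]) simp
qed (use qual_bounds[of j] in auto)

text \<open>Exchanges successes and failures, so that one-sided estimates give two-sided
  ones.\<close>

lemma bernoulli_trials_Not:
  assumes "bernoulli_trials f p"
  shows "bernoulli_trials (\<lambda>r. map_option Not (f r)) (1 - p)"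
  unfolding bernoulli_trials_def
proof (intro conjI allI)
  fix H and a b c :: ennreal
  have "(case map_option Not u of None \<Rightarrow> c | Some x \<Rightarrow> if x then a else b)
      = (case u of None \<Rightarrow> c | Some x \<Rightarrow> if x then b else a)" for u
    by (cases u) auto
  then have "(\<integral>\<^sup>+d. (case map_option Not (f (next_record H d)) of None \<Rightarrow> c | Some x \<Rightarrow> if x then a else b) \<partial>truth)
      = (\<integral>\<^sup>+d. (if f (next_record H d) = None then c else ennreal p * b + ennreal (1 - p) * a) \<partial>truth)"
    using assms by (simp only: bernoulli_trials_def)
  then show "(\<integral>\<^sup>+d. (case map_option Not (f (next_record H d)) of None \<Rightarrow> c | Some x \<Rightarrow> if x then a else b) \<partial>truth)
      = (\<integral>\<^sup>+d. (if map_option Not (f (next_record H d)) = None then c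
           else ennreal (1 - p) * a + ennreal (1 - (1 - p)) * b) \<partial>truth)"
    by (simp add: add.commute cong: if_cong)
qed (use assms in \<open>auto simp: bernoulli_trials_def\<close>)

text \<open>A Chernoff bound along random trial times. The weight is
  \<open>exp (h * (K - (p + \<epsilon>) * N))\<close> for \<open>K\<close> successes in
  \<open>N\<close> trials. Its sum over the trial rounds is finite, so only finitely many of these
  start with weight at least 1, that is, with \<open>K \<ge> (p + \<epsilon>) * N\<close>.\<close>

lemma bernoulli_trials_upper:
  assumes trials: "bernoulli_trials f p" and \<epsilon>: "0 < \<epsilon>"
  shows "AE \<omega> in draws.S. infinite {n. f (record_at \<omega> n) \<noteq> None} \<longrightarrow>
    (\<forall>\<^sub>F n in sequentially. real (count_obs f True (hist M s \<omega> n))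
        < (p + \<epsilon>) * real (count_obs f True (hist M s \<omega> n) + count_obs f False (hist M s \<omega> n)))"
proof -
  obtain h where h: "h > 0" "p * exp (h * (1 - (p + \<epsilon>))) + (1 - p) * exp (- (h * (p + \<epsilon>))) < 1"
    using exponential_tilt_less_1[OF \<epsilon>] by blast
  define a b where "a = exp (h * (1 - (p + \<epsilon>)))" and "b = exp (- (h * (p + \<epsilon>)))"
  \<comment> \<open>The expected loss of weight per trial, so that the drift condition holds with
    equality: \<open>p * (a + \<kappa>) + (1 - p) * (b + \<kappa>) = 1\<close>.\<close>
  define \<kappa> where "\<kappa> = 1 - (p * a + (1 - p) * b)"
  have \<kappa>: "\<kappa> > 0" using h by (simp add: \<kappa>_def a_def b_def)
  have ab: "a > 0" "b > 0" by (simp_all add: a_def b_def)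
  have p: "0 \<le> p" "p \<le> 1" using trials by (auto simp: bernoulli_trials_def)
  define w :: "'b history \<Rightarrow> 'b round_record \<Rightarrow> ennreal" where
    "w H r = (case f r of None \<Rightarrow> 1 | Some x \<Rightarrow> if x then ennreal a else ennreal b)" for H r
  have drift: "(\<integral>\<^sup>+d. w H (next_record H d) + ennreal \<kappa> * of_bool (f (next_record H d) \<noteq> None) \<partial>truth) \<le> 1" for H
  proof -
    have "w H r + ennreal \<kappa> * of_bool (f r \<noteq> None)
        = (case f r of None \<Rightarrow> 1 | Some x \<Rightarrow> if x then ennreal (a + \<kappa>) else ennreal (b + \<kappa>))" for r
      using ab \<kappa> by (auto simp: w_def split: option.split)
    then have "(\<integral>\<^sup>+d. w H (next_record H d) + ennreal \<kappa> * of_bool (f (next_record H d) \<noteq> None) \<partial>truth)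
        = (\<integral>\<^sup>+d. (case f (next_record H d) of None \<Rightarrow> 1 | Some x \<Rightarrow> if x then ennreal (a + \<kappa>) else ennreal (b + \<kappa>)) \<partial>truth)"
      by simp
    also have "\<dots> = (\<integral>\<^sup>+d. (if f (next_record H d) = None then 1
        else ennreal p * ennreal (a + \<kappa>) + ennreal (1 - p) * ennreal (b + \<kappa>)) \<partial>truth)"
      using trials unfolding bernoulli_trials_def by blast
    also have "ennreal p * ennreal (a + \<kappa>) + ennreal (1 - p) * ennreal (b + \<kappa>)
        = ennreal (p * (a + \<kappa>) + (1 - p) * (b + \<kappa>))"
      using p ab \<kappa> by (subst ennreal_plus) (simp_all add: ennreal_mult del: ennreal_plus)
    also have "p * (a + \<kappa>) + (1 - p) * (b + \<kappa>) = 1" by (simp add: \<kappa>_def algebra_simps)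
    finally show ?thesis by (simp cong: if_cong)
  qed
  have wp: "weight_prod w H = ennreal (exp (h * (real (count_obs f True H)
      - (p + \<epsilon>) * real (count_obs f True H + count_obs f False H))))" for H
  proof (induction H)
    case (Cons r H)
    then show ?case
      by (cases "f r")
        (auto simp: w_def a_def b_def algebra_simps simp flip: ennreal_mult exp_add)
  qed simp
  have "AE \<omega> in draws.S. (\<Sum>n. if f (record_at \<omega> n) \<noteq> None then weight_prod w (hist M s \<omega> n) else 0) \<noteq> \<top>"
    using supermartingale_sum_finite[of \<kappa> w "\<lambda>H r. f r \<noteq> None"] \<kappa> drift by simp
  then show ?thesis
  proof eventually_elim
    case (elim \<omega>)
    let ?K = "\<lambda>n. count_obs f True (hist M s \<omega> n)" and ?L = "\<lambda>n. count_obs f False (hist M s \<omega> n)"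
    let ?P = "\<lambda>n. real (?K n) < (p + \<epsilon>) * real (?K n + ?L n)"
    show ?case
    proof
      assume inf: "infinite {n. f (record_at \<omega> n) \<noteq> None}"
      have "finite {n. ennreal 1 \<le> (if f (record_at \<omega> n) \<noteq> None then weight_prod w (hist M s \<omega> n) else 0)}"
        using suminf_ennreal_eq_top[of 1] elim by fastforce
      then obtain n0 where n0: "\<And>n. n0 \<le> n \<Longrightarrow>
          \<not> ennreal 1 \<le> (if f (record_at \<omega> n) \<noteq> None then weight_prod w (hist M s \<omega> n) else 0)"
        unfolding finite_nat_set_iff_bounded by (auto simp: not_less[symmetric])
      have trial: "?P n" if "n0 \<le> n" "f (record_at \<omega> n) \<noteq> None" for n
      proof -
        have "\<not> ennreal 1 \<le> ennreal (exp (h * (real (?K n) - (p + \<epsilon>) * real (?K n + ?L n))))"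
          using n0[OF that(1)] that(2) unfolding wp by simp
        then have "\<not> 1 \<le> exp (h * (real (?K n) - (p + \<epsilon>) * real (?K n + ?L n)))"
          using ennreal_leI by blast
        then have "h * (real (?K n) - (p + \<epsilon>) * real (?K n + ?L n)) < 0" by simp
        then show ?thesis using h(1) by (simp add: mult_less_0_iff)
      qed
      \<comment> \<open>Rounds without a trial are covered too: the counts stay the same until the
        next trial, so a violation would persist up to a trial round.\<close>
      have "?P n" if n: "n0 \<le> n" for n
      proof (rule ccontr)
        assume no: "\<not> ?P n"
        have same: "?K m = ?K n \<and> ?L m = ?L n" if "n \<le> m" for m
          using that
        proof (induction rule: dec_induct)
          case (step m)
          then have "\<not> ?P m" using no by simp
          moreover have "n0 \<le> m" using step(1) n by simp
          ultimately have "f (record_at \<omega> m) = None" using trial[of m] by blast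
          then show ?case using step by (simp add: hist_Suc)
        qed simp
        obtain m where m: "n \<le> m" "f (record_at \<omega> m) \<noteq> None"
          using inf unfolding infinite_nat_iff_unbounded_le by blast
        with same[OF m(1)] trial[of m] n no show False by simp
      qed
      then show "\<forall>\<^sub>F n in sequentially. ?P n" by (auto intro: eventually_sequentiallyI)
    qed
  qed
qed

lemma bernoulli_trials_0:
  assumes "bernoulli_trials f 0"
  shows "AE \<omega> in draws.S. \<forall>n. count_obs f True (hist M s \<omega> n) = 0"
proof -
  have "AE \<omega> in draws.S. \<forall>n. f (record_at \<omega> n) \<noteq> Some True"
  proof (rule AE_hist_draw)
    fix H
    show pred: "Measurable.pred truth (\<lambda>d. f (next_record H d) \<noteq> Some True)"
      using measurable_compose[OF measurable_next_record, of "\<lambda>r. f r \<noteq> Some True" "count_space UNIV"] by simp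
    have "(\<integral>\<^sup>+d. indicator {d. \<not> f (next_record H d) \<noteq> Some True} d \<partial>truth)
        = (\<integral>\<^sup>+d. (case f (next_record H d) of None \<Rightarrow> 0 | Some x \<Rightarrow> if x then 1 else 0) \<partial>truth)"
      by (intro nn_integral_cong) (auto simp: indicator_def split: option.split)
    also have "\<dots> = (\<integral>\<^sup>+d. (if f (next_record H d) = None then 0
        else ennreal 0 * 1 + ennreal (1 - 0) * 0) \<partial>truth)"
      using assms unfolding bernoulli_trials_def by blast
    also have "\<dots> = 0" by (simp cong: if_cong)
    finally show "AE d in truth. f (next_record H d) \<noteq> Some True"
      using pred by (subst AE_iff_nn_integral) (simp_all add: pred_def)
  qed
  then show ?thesis
  proof eventually_elim
    case (elim \<omega>)
    have "count_obs f True (hist M s \<omega> n) = 0" for n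
      using elim by (induction n) (auto simp: hist_Suc)
    then show ?case by blast
  qed
qed

lemma count_obs_total:
  "count_obs f True (hist M s \<omega> n) + count_obs f False (hist M s \<omega> n) = card {i. i < n \<and> f (record_at \<omega> i) \<noteq> None}"
proof (induction n)
  case (Suc n)
  have set_eq: "{i. i < Suc n \<and> f (record_at \<omega> i) \<noteq> None}
     = (if f (record_at \<omega> n) \<noteq> None then insert n {i. i < n \<and> f (record_at \<omega> i) \<noteq> None}
        else {i. i < n \<and> f (record_at \<omega> i) \<noteq> None})"
    by (auto simp: less_Suc_eq)
  show ?case
    unfolding set_eq hist_Suc using Suc
    by (cases "f (record_at \<omega> n)") (simp_all del: not_None_eq)
qed simp

lemma count_obs_at_top:
  assumes "infinite {n. f (record_at \<omega> n) \<noteq> None}"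
  shows "filterlim (\<lambda>n. count_obs f True (hist M s \<omega> n) + count_obs f False (hist M s \<omega> n)) at_top sequentially"
  unfolding filterlim_at_top
proof
  fix C
  obtain B where B: "finite B" "card B = C" "B \<subseteq> {n. f (record_at \<omega> n) \<noteq> None}"
    using infinite_arbitrarily_large[OF assms] by blast
  then obtain n0 where n0: "\<forall>i\<in>B. i < n0" using finite_nat_set_iff_bounded by blast
  have "C \<le> card {i. i < n \<and> f (record_at \<omega> i) \<noteq> None}" if "n0 \<le> n" for n
    unfolding B(2)[symmetric] using B n0 that by (intro card_mono) auto
  then show "\<forall>\<^sub>F n in sequentially. C \<le> count_obs f True (hist M s \<omega> n) + count_obs f False (hist M s \<omega> n)"
    unfolding count_obs_total by (auto intro: eventually_sequentiallyI)
qed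

lemma bernoulli_trials_LLN:
  assumes trials: "bernoulli_trials f p"
  shows "AE \<omega> in draws.S. infinite {n. f (record_at \<omega> n) \<noteq> None} \<longrightarrow>
    (\<lambda>n. real (count_obs f True (hist M s \<omega> n))
       / real (count_obs f True (hist M s \<omega> n) + count_obs f False (hist M s \<omega> n))) \<longlonglongrightarrow> p"
proof -
  let ?g = "\<lambda>r. map_option Not (f r)"
  \<comment> \<open>Only the countably many tolerances \<open>1 / Suc m\<close> are used, so that a
    single null set serves them all.\<close>
  have "AE \<omega> in draws.S. \<forall>m. infinite {n. f (record_at \<omega> n) \<noteq> None} \<longrightarrow>
    (\<forall>\<^sub>F n in sequentially. real (count_obs f True (hist M s \<omega> n))
        < (p + 1 / Suc m) * real (count_obs f True (hist M s \<omega> n) + count_obs f False (hist M s \<omega> n)))"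
    unfolding AE_all_countable by (intro allI bernoulli_trials_upper trials) simp
  moreover have "AE \<omega> in draws.S. \<forall>m. infinite {n. ?g (record_at \<omega> n) \<noteq> None} \<longrightarrow>
    (\<forall>\<^sub>F n in sequentially. real (count_obs ?g True (hist M s \<omega> n))
        < (1 - p + 1 / Suc m) * real (count_obs ?g True (hist M s \<omega> n) + count_obs ?g False (hist M s \<omega> n)))"
    unfolding AE_all_countable by (intro allI bernoulli_trials_upper bernoulli_trials_Not trials) simp
  ultimately show ?thesis
  proof eventually_elim
    case (elim \<omega>)
    let ?K = "\<lambda>n. real (count_obs f True (hist M s \<omega> n))" and ?L = "\<lambda>n. real (count_obs f False (hist M s \<omega> n))"
    show ?case
    proof
      assume inf: "infinite {n. f (record_at \<omega> n) \<noteq> None}"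
      have up: "\<forall>\<^sub>F n in sequentially. ?K n < (p + 1 / Suc m) * (?K n + ?L n)" for m
        using elim(1) inf by simp
      have lo: "\<forall>\<^sub>F n in sequentially. ?L n < (1 - p + 1 / Suc m) * (?K n + ?L n)" for m
        using elim(2) inf by (simp add: count_obs_Not add.commute)
      have "(\<lambda>n. ?K n / (?K n + ?L n)) \<longlonglongrightarrow> p"
      proof (rule tendstoI)
        fix e :: real assume "0 < e"
        then obtain m where m: "1 / Suc m < e" using nat_approx_posE by metis
        show "\<forall>\<^sub>F n in sequentially. dist (?K n / (?K n + ?L n)) p < e"
          using up[of m] lo[of m]
        proof eventually_elim
          case (elim n)
          let ?N = "?K n + ?L n"
          have N: "?N > 0"
          proof (rule ccontr)
            assume "\<not> ?N > 0"
            then have "?K n = 0" "?L n = 0" by linarith+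
            with elim(1) show False by simp
          qed
          have "?K n / ?N < p + 1 / Suc m" using elim(1) N by (simp only: divide_less_eq if_True)
          moreover have "?L n / ?N < 1 - p + 1 / Suc m" using elim(2) N by (simp only: divide_less_eq if_True)
          moreover have "?L n / ?N = 1 - ?K n / ?N" using N by (simp add: field_simps)
          ultimately have "\<bar>?K n / ?N - p\<bar> < 1 / Suc m" unfolding abs_less_iff by linarith
          then show ?case using m by (simp only: dist_real_def)
        qed
      qed
      then show "(\<lambda>n. ?K n / real (count_obs f True (hist M s \<omega> n) + count_obs f False (hist M s \<omega> n))) \<longlonglongrightarrow> p"
        by simp
    qed
  qed
qed

text \<open>Supplies the one-sided counts that concentration demands at an endpoint, where a single
  contrary observation would make the likelihood of the truth 0.\<close>

lemma bernoulli_trials_degenerate: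
  assumes trials: "bernoulli_trials f p"
  shows "AE \<omega> in draws.S. (p = 0 \<longrightarrow> (\<forall>n. count_obs f True (hist M s \<omega> n) = 0))
    \<and> (p = 1 \<longrightarrow> (\<forall>n. count_obs f False (hist M s \<omega> n) = 0))"
proof (rule AE_conjI)
  show "AE \<omega> in draws.S. p = 0 \<longrightarrow> (\<forall>n. count_obs f True (hist M s \<omega> n) = 0)"
    using bernoulli_trials_0[of f] trials by (cases "p = 0") auto
  show "AE \<omega> in draws.S. p = 1 \<longrightarrow> (\<forall>n. count_obs f False (hist M s \<omega> n) = 0)"
    using bernoulli_trials_0[of "\<lambda>r. map_option Not (f r)"] bernoulli_trials_Not[OF trials]
    by (cases "p = 1") (auto simp: count_obs_Not)
qed

text \<open>The sufficient event restricts only the value and the fits of the other businesses. It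
  mentions neither history nor beliefs, which makes \<open>\<delta>\<close> uniform in
  \<open>H\<close>.\<close>

lemma inspection_probability:
  assumes \<epsilon>: "0 < \<epsilon>"
  shows "\<exists>\<delta>>0. \<forall>H. possible H \<longrightarrow> \<epsilon> \<le> top_index M H j (posted H j) \<longrightarrow>
     ennreal \<delta> \<le> emeasure truth {d \<in> space truth. fits (next_record H d) j \<noteq> None}"
proof -
  interpret Q: prob_space "bernoulli_PiM (qual M)" by (rule prob_space_bernoulli_PiM)
  interpret FQ: prob_space "bernoulli_PiM (fit M) \<Otimes>\<^sub>M bernoulli_PiM (qual M)"
    by (intro prob_space_pair prob_space_bernoulli_PiM)
  let ?V = "{Vbar M - \<epsilon><..}"
  \<comment> \<open>The event that no other business fits, coded as a partial observation so that
    \<open>emeasure_bernoulli_obs\<close> gives its probability; \<open>None\<close> leaves the fit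
    of \<open>j\<close> itself free.\<close>
  define u :: "'b \<Rightarrow> bool option" where "u k = (if k = j then None else Some False)" for k
  let ?F = "{F. \<forall>k. u k \<in> {None, Some (F k)}}"
  let ?E = "?V \<times> (?F \<times> (UNIV :: ('b \<Rightarrow> bool) set))"
  have sets: "X \<in> sets (bernoulli_PiM \<pi>)" for X and \<pi> :: "'b \<Rightarrow> real"
    using measurable_sets[OF measurable_bernoulli_PiM_count_space, of X] by simp
  have E: "?E \<in> sets truth" unfolding draw_law_eq by (intro pair_measureI sets) simp
  have "emeasure truth ?E = emeasure (value_law M) ?V * (emeasure (bernoulli_PiM (fit M)) ?F * 1)"
    using Q.emeasure_space_1
    by (simp add: draw_law_eq FQ.emeasure_pair_measure_Times Q.emeasure_pair_measure_Times sets)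
  moreover have "0 < emeasure (bernoulli_PiM (fit M)) ?F"
    unfolding emeasure_bernoulli_obs
    using fit_bounds by (auto simp: option_lik_def u_def less_imp_le intro!: prod_pos)
  ultimately have "0 < emeasure truth ?E"
    using Vbar_mass[OF \<epsilon>] by (simp only: mult_1_right ennreal_zero_less_mult_iff)
  then have pos: "0 < measure truth ?E" by (simp only: truth.emeasure_eq_measure ennreal_less_zero_iff)
  have "ennreal (measure truth ?E) \<le> emeasure truth {d \<in> space truth. fits (next_record H d) j \<noteq> None}"
    if H: "possible H" "\<epsilon> \<le> top_index M H j (posted H j)" for H
  proof -
    have "fits (next_record H (v, F, q)) j \<noteq> None" if v: "Vbar M - \<epsilon> < v" and F: "\<forall>k. u k \<in> {None, Some (F k)}" for v F q
    proof -
      have Q: "0 \<le> qual_mean H j" "qual_mean H j \<le> 1" by (rule qual_mean_bounds[OF H(1)])+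
      \<comment> \<open>This is the loss of index from \<open>Vbar M\<close> to \<open>v\<close>.
        The slope lies between 0 and 1, so the loss is less than \<open>\<epsilon>\<close> below
        \<open>Vbar M\<close>, and there is none above.\<close>
      have "(Vbar M - v) * qual_mean H j < \<epsilon>"
      proof (cases "v \<le> Vbar M")
        case True
        then have "(Vbar M - v) * qual_mean H j \<le> Vbar M - v" using Q by (simp add: mult_left_le)
        then show ?thesis using v by simp
      next
        case False
        then have "(Vbar M - v) * qual_mean H j \<le> 0" using Q by (simp add: mult_nonpos_nonneg)
        then show ?thesis using \<epsilon> by simp
      qed
      then have "0 < sigma_index (cost M) (posted H j) (fit_mean H j) (qual_mean H j) v"
        using H(2) by (simp add: top_index_def sigma_index_def algebra_simps)
      then have "j \<in> set (plan (cost M) (tie M H) (fit_mean H) (qual_mean H) (posted H) v)"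
        using valid by (simp add: plan_def Let_def valid_market_def)
      moreover have "\<forall>k. k \<noteq> j \<longrightarrow> \<not> F k" using F by (auto simp: u_def split: if_splits)
      ultimately have "j \<in> set (inspections F (plan (cost M) (tie M H) (fit_mean H) (qual_mean H) (posted H) v))"
        by (intro inspected_if_no_other_fit)
      then show ?thesis by (simp add: next_record_def play_eq fits_plan_record)
    qed
    then have "?E \<subseteq> {d \<in> space truth. fits (next_record H d) j \<noteq> None}" by auto
    moreover have "{d \<in> space truth. fits (next_record H d) j \<noteq> None} \<in> sets truth"
      using measurable_sets[OF measurable_next_record[where \<theta> = "(fit M, qual M)" and H = H], of "{r. fits r j \<noteq> None}"]
      by (simp add: vimage_def)
    ultimately show ?thesis
      unfolding truth.emeasure_eq_measure[symmetric] by (rule emeasure_mono)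
  qed
  then show ?thesis using pos by blast
qed

lemma sale_obs_iff_fit: "sale_obs (next_record H d) j \<noteq> None \<longleftrightarrow> fits (next_record H d) j = Some True"
  by (simp add: next_record_def play_eq sale_obs_plan_record fits_plan_record)

text \<open>Sales of \<open>j\<close> are the successes among its inspections. If they were bounded,
  the success frequency would tend to 0 and not to \<open>fit M j > 0\<close>.\<close>

lemma infinitely_inspected_imp_infinitely_sold:
  assumes inf: "infinite {n. fits (record_at \<omega> n) j \<noteq> None}"
    and lim: "(\<lambda>n. real (count_obs (\<lambda>r. fits r j) True (hist M s \<omega> n))
       / real (count_obs (\<lambda>r. fits r j) True (hist M s \<omega> n) + count_obs (\<lambda>r. fits r j) False (hist M s \<omega> n)))
       \<longlonglongrightarrow> fit M j"
  shows "infinite {n. sale_obs (record_at \<omega> n) j \<noteq> None}"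
proof
  assume fin: "finite {n. sale_obs (record_at \<omega> n) j \<noteq> None}"
  let ?K = "\<lambda>n. count_obs (\<lambda>r. fits r j) True (hist M s \<omega> n)"
  let ?N = "\<lambda>n. ?K n + count_obs (\<lambda>r. fits r j) False (hist M s \<omega> n)"
  define C where "C = card {n. sale_obs (record_at \<omega> n) j \<noteq> None}"
  have "?K n = card {i. i < n \<and> sale_obs (record_at \<omega> i) j \<noteq> None}" for n
  proof (induction n)
    case (Suc n)
    have set_eq: "{i. i < Suc n \<and> sale_obs (record_at \<omega> i) j \<noteq> None}
      = (if sale_obs (record_at \<omega> n) j \<noteq> None then insert n {i. i < n \<and> sale_obs (record_at \<omega> i) j \<noteq> None}
         else {i. i < n \<and> sale_obs (record_at \<omega> i) j \<noteq> None})"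
      by (auto simp: less_Suc_eq)
    show ?case
      unfolding set_eq hist_Suc using Suc sale_obs_iff_fit[of "hist M s \<omega> n" "\<omega> n" j]
      by (simp del: not_None_eq)
  qed simp
  moreover have "card {i. i < n \<and> sale_obs (record_at \<omega> i) j \<noteq> None} \<le> C" for n
    unfolding C_def by (intro card_mono fin) auto
  ultimately have K: "?K n \<le> C" for n by simp
  have N: "filterlim (\<lambda>n. real (?N n)) at_top sequentially"
    using filterlim_compose[OF filterlim_real_sequentially count_obs_at_top[OF inf]] .
  have "(\<lambda>n. real C / real (?N n)) \<longlonglongrightarrow> 0"
    by (rule tendsto_divide_0[OF tendsto_const filterlim_at_top_imp_at_infinity[OF N]])
  then have "(\<lambda>n. real (?K n) / real (?N n)) \<longlonglongrightarrow> 0"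
    by (rule Lim_null_comparison[rotated]) (intro always_eventually allI, simp add: K divide_right_mono)
  from LIMSEQ_unique[OF lim this] fit_bounds[of j] show False by simp
qed

subsection \<open>Learned or lost\<close>

text \<open>A statement about a single path: the almost sure facts enter as hypotheses, so that no
  probability is left in this step.\<close>

lemma infinitely_inspected_imp_learned:
  assumes poss: "\<And>n. possible (hist M s \<omega> n)"
    and inf: "infinite {n. fits (record_at \<omega> n) j \<noteq> None}"
    and F: "infinite {n. fits (record_at \<omega> n) j \<noteq> None} \<longrightarrow>
      (\<lambda>n. real (count_obs (\<lambda>r. fits r j) True (hist M s \<omega> n))
       / real (count_obs (\<lambda>r. fits r j) True (hist M s \<omega> n) + count_obs (\<lambda>r. fits r j) False (hist M s \<omega> n)))
       \<longlonglongrightarrow> fit M j"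
    and Q: "infinite {n. sale_obs (record_at \<omega> n) j \<noteq> None} \<longrightarrow>
      (\<lambda>n. real (count_obs (\<lambda>r. sale_obs r j) True (hist M s \<omega> n))
       / real (count_obs (\<lambda>r. sale_obs r j) True (hist M s \<omega> n) + count_obs (\<lambda>r. sale_obs r j) False (hist M s \<omega> n)))
       \<longlonglongrightarrow> qual M j"
    and Q01: "(qual M j = 0 \<longrightarrow> (\<forall>n. count_obs (\<lambda>r. sale_obs r j) True (hist M s \<omega> n) = 0))
      \<and> (qual M j = 1 \<longrightarrow> (\<forall>n. count_obs (\<lambda>r. sale_obs r j) False (hist M s \<omega> n) = 0))"
  shows "learned M (hist M s \<omega>) j"
  unfolding learned_def belief_eq[OF poss]
proof (intro conjI)
  have limF: "(\<lambda>n. real (count_obs (\<lambda>r. fits r j) True (hist M s \<omega> n))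
       / real (count_obs (\<lambda>r. fits r j) True (hist M s \<omega> n) + count_obs (\<lambda>r. fits r j) False (hist M s \<omega> n)))
       \<longlonglongrightarrow> fit M j"
    using F inf by (rule mp)
  show "concentrates_at (\<lambda>n. bayes_update (priorF M j) (fit_lik (hist M s \<omega> n) j)) (fit M j)"
    by (rule bernoulli_posterior_concentrates[OF prior(1) prior_unitF support(1) _ _ limF
          count_obs_at_top[OF inf] _ _ possible_integral(1)[OF poss]])
      (use fit_bounds[of j] in auto)
  have infQ: "infinite {n. sale_obs (record_at \<omega> n) j \<noteq> None}"
    by (rule infinitely_inspected_imp_infinitely_sold[OF inf limF])
  show "concentrates_at (\<lambda>n. bayes_update (priorQ M j) (qual_lik (hist M s \<omega> n) j)) (qual M j)"
    by (rule bernoulli_posterior_concentrates[OF prior(2) prior_unit(2) support(2) qual_bounds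
          mp[OF Q infQ] count_obs_at_top[OF infQ] _ _ possible_integral(2)[OF poss]])
      (use Q01 in auto)
qed

text \<open>Without an inspection there is no sale either, so all four observation counts of
  \<open>j\<close> freeze after the last inspection, whatever happens to the other
  businesses.\<close>

lemma finitely_inspected_imp_belief_const:
  assumes poss: "\<And>n. possible (hist M s \<omega> n)"
    and fin: "finite {n. fits (record_at \<omega> n) j \<noteq> None}"
  obtains n0 where "\<And>n. n0 \<le> n \<Longrightarrow> beliefF M (hist M s \<omega> n) j = beliefF M (hist M s \<omega> n0) j"
    "\<And>n. n0 \<le> n \<Longrightarrow> beliefQ M (hist M s \<omega> n) j = beliefQ M (hist M s \<omega> n0) j"
proof -
  obtain n0 where n0: "\<forall>i\<in>{n. fits (record_at \<omega> n) j \<noteq> None}. i < n0"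
    using fin finite_nat_set_iff_bounded by blast
  have none: "fits (record_at \<omega> n) j = None \<and> sale_obs (record_at \<omega> n) j = None" if "n0 \<le> n" for n
  proof -
    have "fits (record_at \<omega> n) j = None" using n0 that leD by blast
    then show ?thesis using sale_obs_iff_fit[of "hist M s \<omega> n" "\<omega> n" j] by auto
  qed
  have const: "count_obs (\<lambda>r. fits r j) b (hist M s \<omega> n) = count_obs (\<lambda>r. fits r j) b (hist M s \<omega> n0)
      \<and> count_obs (\<lambda>r. sale_obs r j) b (hist M s \<omega> n) = count_obs (\<lambda>r. sale_obs r j) b (hist M s \<omega> n0)"
    if "n0 \<le> n" for n b
    using that by (induction rule: dec_induct) (simp_all add: hist_Suc none)
  show ?thesis
  proof (rule that[of n0])
    fix n assume "n0 \<le> n"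
    note const = const[OF this]
    show "beliefF M (hist M s \<omega> n) j = beliefF M (hist M s \<omega> n0) j"
      "beliefQ M (hist M s \<omega> n) j = beliefQ M (hist M s \<omega> n0) j"
      by (simp_all add: belief_eq[OF poss] const)
  qed
qed

text \<open>\<open>possible\<close> belongs to the event because the lower bound on the inspection
  probability was proved for such histories only.\<close>

lemma AE_infinitely_inspected_if_index:
  "AE \<omega> in draws.S. \<forall>m. infinite {n. possible (hist M s \<omega> n) \<and>
       1 / Suc m \<le> top_index M (hist M s \<omega> n) j (posted (hist M s \<omega> n) j)}
     \<longrightarrow> infinite {n. fits (record_at \<omega> n) j \<noteq> None}"
  unfolding AE_all_countable
proof
  fix m
  obtain \<delta> where "0 < \<delta>" "\<And>H. possible H \<Longrightarrow> 1 / Suc m \<le> top_index M H j (posted H j) \<Longrightarrow>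
     ennreal \<delta> \<le> emeasure truth {d \<in> space truth. fits (next_record H d) j \<noteq> None}"
    using inspection_probability[of "1 / Suc m" j] by auto
  then show "AE \<omega> in draws.S. infinite {n. possible (hist M s \<omega> n) \<and>
       1 / Suc m \<le> top_index M (hist M s \<omega> n) j (posted (hist M s \<omega> n) j)}
     \<longrightarrow> infinite {n. fits (record_at \<omega> n) j \<noteq> None}"
    by (intro conditional_Borel_Cantelli[of \<delta>]) auto
qed

lemma finitely_inspected_imp_lost:
  assumes dr: "demand_responsive M j"
    and const: "\<And>n. n0 \<le> n \<Longrightarrow> beliefF M (hist M s \<omega> n) j = beliefF M (hist M s \<omega> n0) j"
      "\<And>n. n0 \<le> n \<Longrightarrow> beliefQ M (hist M s \<omega> n) j = beliefQ M (hist M s \<omega> n0) j"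
    and nonvanishing: "\<not> lost M (hist M s \<omega>) j \<Longrightarrow>
      \<not> (\<lambda>i. top_index M (hist M s \<omega> i) j (price M j (hist M s \<omega> i) (s i j))) \<longlonglongrightarrow> 0"
    and poss: "\<And>n. possible (hist M s \<omega> n)"
    and fin: "finite {n. fits (record_at \<omega> n) j \<noteq> None}"
    and index: "\<forall>m. infinite {n. possible (hist M s \<omega> n) \<and>
       1 / Suc m \<le> top_index M (hist M s \<omega> n) j (posted (hist M s \<omega> n) j)}
     \<longrightarrow> infinite {n. fits (record_at \<omega> n) j \<noteq> None}"
  shows "lost M (hist M s \<omega>) j"
proof (rule ccontr)
  assume not_lost: "\<not> lost M (hist M s \<omega>) j"
  let ?X = "\<lambda>i. top_index M (hist M s \<omega> i) j (price M j (hist M s \<omega> i) (s i j))"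
  \<comment> \<open>After \<open>n0\<close> the index at any fixed price no longer moves, so one
    later round with a positive index at price 0 makes it positive in all of them.\<close>
  have top: "top_index M (hist M s \<omega> n) j p = top_index M (hist M s \<omega> n0) j p" if "n0 \<le> n" for n p
    using const[OF that] by (simp add: top_index_def)
  obtain n where n: "n0 \<le> n" "\<not> top_index M (hist M s \<omega> n) j 0 \<le> 0"
    using not_lost unfolding lost_def by blast
  then have top0: "0 < top_index M (hist M s \<omega> n0) j 0" using top[OF n(1)] by simp
  have "\<exists>p\<ge>0. 0 < top_index M (hist M s \<omega> n) j p" if "n0 \<le> n" for n
    using top0 top[OF that] by (intro exI[of _ 0]) simp
  then have pos: "0 < ?X n" if "n0 \<le> n" for n
    using dr that unfolding demand_responsive_def by blast
  \<comment> \<open>Not tending to 0 only says that the absolute value of the index is at least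
    \<open>r\<close> infinitely often; demand-responsiveness provides the sign.\<close>
  obtain r where r: "0 < r" "\<And>N. \<exists>n\<ge>N. r \<le> \<bar>?X n\<bar>"
    using nonvanishing[OF not_lost] unfolding LIMSEQ_iff by (auto simp: not_less)
  obtain m where m: "1 / Suc m < r" using nat_approx_posE[OF r(1)] by blast
  have "infinite {n. possible (hist M s \<omega> n) \<and> 1 / Suc m \<le> top_index M (hist M s \<omega> n) j (posted (hist M s \<omega> n) j)}"
    unfolding infinite_nat_iff_unbounded_le
  proof
    fix N
    obtain n where n: "max N n0 \<le> n" "r \<le> \<bar>?X n\<bar>" using r(2) by blast
    then have "1 / Suc m \<le> ?X n" using pos[of n] m by simp
    then show "\<exists>n\<ge>N. n \<in> {n. possible (hist M s \<omega> n) \<and>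
        1 / Suc m \<le> top_index M (hist M s \<omega> n) j (posted (hist M s \<omega> n) j)}"
      using n poss[of n] by (intro exI[of _ n]) (simp add: posted_def)
  qed
  with index fin show False by blast
qed

end

theorem proposition7p2:
  fixes M :: "('b::finite, 's) market" and j :: 'b and s :: "nat \<Rightarrow> 'b \<Rightarrow> 's"
  assumes "valid_market M"
    and "\<forall>k. demand_responsive M k"
    and "nonvanishing_index M s j"
  shows "AE \<omega> in consumer_law M.
    (let h = hist M s \<omega> in
      \<exists>PF PQ.
        real_distribution PF \<and> real_distribution PQ \<and>
        weak_conv_m (\<lambda>i. beliefF M (h i) j) PF \<and>
        weak_conv_m (\<lambda>i. beliefQ M (h i) j) PQ \<and>
        (learned M h j \<and> PF = return borel (fit M j) \<and> PQ = return borel (qual M j) \<or>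
         lost M h j))"
proof -
  interpret market_run M s by standard (rule assms(1))
  \<comment> \<open>The head of the history after \<open>Suc i\<close> rounds is the record of round
    \<open>i\<close>.\<close>
  have inspected: "{i. inspected (hist M s \<omega>) i j} = {n. fits (record_at \<omega> n) j \<noteq> None}" for \<omega>
    by (simp add: inspected_def hist_Suc)
  have nonvanishing: "AE \<omega> in draws.S. finite {n. fits (record_at \<omega> n) j \<noteq> None} \<longrightarrow> \<not> lost M (hist M s \<omega>) j \<longrightarrow>
      \<not> (\<lambda>i. top_index M (hist M s \<omega> i) j (price M j (hist M s \<omega> i) (s i j))) \<longlonglongrightarrow> 0"
    using assms(3) unfolding nonvanishing_index_def consumer_law_def Let_def inspected .
  \<comment> \<open>All almost sure facts are intersected here; what follows argues on a fixed
    path.\<close>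
  show ?thesis
    unfolding consumer_law_def Let_def
    using AE_possible nonvanishing bernoulli_trials_LLN[OF bernoulli_trials_fit[of j]]
      bernoulli_trials_LLN[OF bernoulli_trials_qual[of j]]
      bernoulli_trials_degenerate[OF bernoulli_trials_qual[of j]] AE_infinitely_inspected_if_index[of j]
  proof eventually_elim
    case (elim \<omega>)
    note poss = spec[OF elim(1)]
    show ?case
    proof (cases "finite {n. fits (record_at \<omega> n) j \<noteq> None}")
      case False
      have learned: "learned M (hist M s \<omega>) j"
        by (rule infinitely_inspected_imp_learned[OF poss False elim(3-5)])
      then have "weak_conv_m (\<lambda>i. beliefF M (hist M s \<omega> i) j) (return borel (fit M j))"
        and "weak_conv_m (\<lambda>i. beliefQ M (hist M s \<omega> i) j) (return borel (qual M j))"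
        unfolding learned_def
        by (auto intro!: weak_conv_concentrates_at real_distribution_belief poss)
      moreover have "real_distribution (return borel x)" for x :: real
        by (simp add: real_distribution_def real_distribution_axioms_def prob_space_return)
      ultimately show ?thesis using learned by blast
    next
      case True
      obtain n0 where n0: "\<And>n. n0 \<le> n \<Longrightarrow> beliefF M (hist M s \<omega> n) j = beliefF M (hist M s \<omega> n0) j"
          "\<And>n. n0 \<le> n \<Longrightarrow> beliefQ M (hist M s \<omega> n) j = beliefQ M (hist M s \<omega> n0) j"
        using finitely_inspected_imp_belief_const[OF poss True] by blast
      have "lost M (hist M s \<omega>) j"
        using assms(2) elim(2) True
        by (intro finitely_inspected_imp_lost[OF _ n0 _ poss True elim(6)]) auto
      moreover have "weak_conv_m (\<lambda>i. beliefF M (hist M s \<omega> i) j) (beliefF M (hist M s \<omega> n0) j)"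
        "weak_conv_m (\<lambda>i. beliefQ M (hist M s \<omega> i) j) (beliefQ M (hist M s \<omega> n0) j)"
        using n0 by (blast intro: weak_conv_eventually_const)+
      ultimately show ?thesis using real_distribution_belief[OF poss] by blast
    qed
  qed
qed

end
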